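(* Let $\mathsf{M}$ be a matroid of rank $\operatorname{rk}\mathsf{M}\ge1$ with realization $W\subseteq\mathbb{K}^E$. Then $\mathsf{M}$ is connected if and only if $\mathsf{M}$ has no loops and $\psi_W$ is irreducible. In particular, if $\mathsf{M}=\bigoplus_{i=1}^n\mathsf{M}_i$ with connected components $\mathsf{M}_i$ and induced decomposition $W=\bigoplus_{i=1}^nW_i$, then $\psi_W=\prod_{i=1}^n\psi_{W_i}$ where $\psi_{W_i}$ is irreducible if $\operatorname{rk}\mathsf{M}_i\ge1$, and $\psi_{W_i}=1$ otherwise.
   Context: $\mathbb{K}$ is a field and $E$ a finite set, regarded as the standard basis of $\mathbb{K}^E$, with coordinates $x_e=e^\vee$ and $\mathbb{K}[x]=\mathbb{K}[x_e\mid e\in E]$. A subspace $W\subseteq\mathbb{K}^E$ is a realization of the matroid $\mathsf{M}$ on $E$ if the independent sets of $\mathsf{M}$ are exactly the $S\subseteq E$ such that the family $(e^\vee|_W)_{e\in S}$ is linearly independent in $W^\vee$. Then $r:=\dim W=\operatorname{rk}\mathsf{M}$. If $w^1,\dots,w^r$ is a basis of $W$ and $w^i_e=e^\vee(w^i)$, the configuration polynomial of $W$ is $$\psi_W=\sum_{B}\det\big((w^i_e)_{1\le i\le r,\ e\in B}\big)^2\prod_{e\in B}x_e\in\mathbb{K}[x],$$ the sum running over all bases $B$ of $\mathsf{M}$; $\psi_W=1$ if $r=0$. It is well defined only up to multiplication by $c^2$ with $c\in\mathbb{K}^*$; formulas involving configuration polynomials are meant to hold for suitable choices of these factors. If $\mathsf{M}=\bigoplus_i\mathsf{M}_i$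 with $\mathsf{M}_i$ on $E_i$ and $E=\bigsqcup_iE_i$, then $W=\bigoplus_iW_i$ where $W_i:=W\cap\mathbb{K}^{E_i}$ realizes $\mathsf{M}_i$; this is the induced decomposition. A matroid is connected if it is not a direct sum of two matroids on nonempty sets. A loop is an element contained in no basis. *)

theory Defs
  imports
    "HOL-Analysis.Cartesian_Space"
    "HOL-Library.Poly_Mapping"
    "Jordan_Normal_Form.Determinant"
begin

no_notation Matrix.vec_index (infixl "$" 100)

record 'e pre_matroid =
  ground :: "'e set"
  indep :: "'e set set"

definition matroid :: "'e pre_matroid \<Rightarrow> bool" where
  "matroid M \<longleftrightarrow>
     finite (ground M) \<and>
     (\<forall>S\<in>indep M. S \<subseteq> ground M) \<and>
     {} \<in> indep M \<and>
     (\<forall>S\<in>indep M. \<forall>T. T \<subseteq> S \<longrightarrow> T \<in> indep M) \<and>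
     (\<forall>S\<in>indep M. \<forall>T\<in>indep M. card S < card T \<longrightarrow> (\<exists>e\<in>T - S. insert e S \<in> indep M))"

definition matroid_basis :: "'e pre_matroid \<Rightarrow> 'e set \<Rightarrow> bool" where
  "matroid_basis M B \<longleftrightarrow> B \<in> indep M \<and> (\<forall>S\<in>indep M. B \<subseteq> S \<longrightarrow> S = B)"

definition matroid_rank :: "'e pre_matroid \<Rightarrow> nat" where
  "matroid_rank M = Max (card ` indep M)"

definition loop :: "'e pre_matroid \<Rightarrow> 'e \<Rightarrow> bool" where
  "loop M e \<longleftrightarrow> e \<in> ground M \<and> (\<forall>B. matroid_basis M B \<longrightarrow> e \<notin> B)"

definition is_direct_sum :: "'e pre_matroid \<Rightarrow> 'i set \<Rightarrow> ('i \<Rightarrow> 'e pre_matroid) \<Rightarrow> bool" where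
  "is_direct_sum M I N \<longleftrightarrow>
     disjoint_family_on (\<lambda>i. ground (N i)) I \<and>
     ground M = (\<Union>i\<in>I. ground (N i)) \<and>
     indep M = {\<Union>i\<in>I. S i |S. \<forall>i\<in>I. S i \<in> indep (N i)}"

definition connected_matroid :: "'e pre_matroid \<Rightarrow> bool" where
  "connected_matroid M \<longleftrightarrow>
     \<not> (\<exists>N :: bool \<Rightarrow> 'e pre_matroid.
          (\<forall>i. matroid (N i) \<and> ground (N i) \<noteq> {}) \<and> is_direct_sum M UNIV N)"

definition coord_space :: "'e set \<Rightarrow> ('k::field ^ 'e) set" where
  "coord_space F = {v. \<forall>e. e \<notin> F \<longrightarrow> v $ e = 0}"

text \<open>Linear independence in the dual of \<open>W\<close> of the family (not the set: two
  coordinate functions may agree on \<open>W\<close>) of restricted coordinate functions indexed by \<open>S\<close>.\<close>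

definition coords_independent :: "('k::field ^ 'e::finite) set \<Rightarrow> 'e set \<Rightarrow> bool" where
  "coords_independent W S \<longleftrightarrow>
     (\<forall>c :: 'e \<Rightarrow> 'k. (\<forall>w\<in>W. (\<Sum>e\<in>S. c e * w $ e) = 0) \<longrightarrow> (\<forall>e\<in>S. c e = 0))"

definition realizes :: "('k::field ^ 'e::finite) set \<Rightarrow> 'e pre_matroid \<Rightarrow> bool" where
  "realizes W M \<longleftrightarrow>
     vec.subspace W \<and> W \<subseteq> coord_space (ground M) \<and>
     indep M = {S. S \<subseteq> ground M \<and> coords_independent W S}"

definition ordered_basis :: "('k::field ^ 'e::finite) set \<Rightarrow> ('k ^ 'e) list \<Rightarrow> bool" where
  "ordered_basis W ws \<longleftrightarrow>
     distinct ws \<and> vec.independent (set ws) \<and> vec.span (set ws) = W"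

type_synonym ('e, 'k) mv_poly = "('e \<Rightarrow>\<^sub>0 nat) \<Rightarrow>\<^sub>0 'k"

definition mv_const :: "'k::zero \<Rightarrow> ('e, 'k) mv_poly" where
  "mv_const c = Poly_Mapping.single 0 c"

definition mv_var :: "'e \<Rightarrow> ('e, 'k::zero_neq_one) mv_poly" where
  "mv_var e = Poly_Mapping.single (Poly_Mapping.single e 1) 1"

text \<open>An arbitrary enumeration of the columns: it affects a maximal minor only by its
  sign, and only squares of minors are used.\<close>

definition enumeration :: "'e set \<Rightarrow> 'e list" where
  "enumeration B = (SOME es. distinct es \<and> set es = B)"

definition maximal_minor :: "('k::field ^ 'e) list \<Rightarrow> 'e set \<Rightarrow> 'k" where
  "maximal_minor ws B =
     Determinant.det (Matrix.mat (length ws) (length ws) (\<lambda>(i, j). (ws ! i) $ (enumeration B ! j)))"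

definition config_poly ::
    "'e pre_matroid \<Rightarrow> ('k::field ^ 'e::finite) list \<Rightarrow> ('e, 'k) mv_poly" where
  "config_poly M ws =
     (\<Sum>B | matroid_basis M B. mv_const ((maximal_minor ws B)\<^sup>2) * (\<Prod>e\<in>B. mv_var e))"

text \<open>\<open>p\<close> is \<open>\<psi>\<^sub>W\<close> for some choice of basis of \<open>W\<close>; here \<open>W\<close> is meant to realize \<open>M\<close>.\<close>

definition is_config_poly ::
    "'e pre_matroid \<Rightarrow> ('k::field ^ 'e::finite) set \<Rightarrow> ('e, 'k) mv_poly \<Rightarrow> bool" where
  "is_config_poly M W p \<longleftrightarrow> (\<exists>ws. ordered_basis W ws \<and> p = config_poly M ws)"

lemma ex_is_config_poly:
  assumes "vec.subspace W"
  shows "\<exists>p. is_config_poly M W p"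
proof -
  obtain B where B: "B \<subseteq> W" "vec.independent B" "W \<subseteq> vec.span B"
    using vec.basis_exists by metis
  obtain ws where ws: "set ws = B" "distinct ws"
    using finite_distinct_list vec.finiteI_independent[OF B(2)] by metis
  have "vec.span B = W"
    using B assms by (simp add: vec.span_minimal subset_antisym)
  with ws B(2) show ?thesis
    by (auto simp: is_config_poly_def ordered_basis_def)
qed

end

theory Submission
  imports Defs
begin

text \<open>
  All exponents in \<open>\<psi>\<^sub>W\<close> are at most one, and the coefficient of \<open>\<Prod>e\<in>B. x\<^sub>e\<close> is the square of
  a maximal minor, nonzero because the coordinates in a basis are independent on \<open>W\<close>. So the
  support of \<open>\<psi>\<^sub>W\<close> is the set of bases of \<open>M\<close>, whatever the field.

  \<^emph>\<open>Connected implies irreducible.\<close> Suppose \<open>\<psi>\<^sub>W = a b\<close>. Degrees in a fixed variable add up in a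
  product of nonzero polynomials, so no variable occurs in both \<open>a\<close> and \<open>b\<close>
  (\<open>multilinear_factors_disjoint\<close>); hence nothing cancels and the support of \<open>a b\<close> is the full
  sumset of the supports (\<open>keys_mult_multilinear\<close>). With \<open>P\<close> the set of variables of \<open>a\<close>, this says
  that any two bases \<open>B\<close>, \<open>B'\<close> can be recombined to the basis \<open>(B \<inter> P) \<union> (B' - P)\<close>. If \<open>a\<close> and \<open>b\<close>
  are nonunits, both \<open>P\<close> and its complement are nonempty, and the recombination property makes \<open>M\<close> the
  direct sum of its restrictions to them (\<open>bases_split_imp_disconnected\<close>). The same criterion with
  \<open>P = {e}\<close> shows that a connected matroid of positive rank has no loop.

  \<^emph>\<open>Product formula.\<close> Let \<open>M\<close> be the direct sum of matroids \<open>N i\<close> on \<open>E i\<close>. The coordinates in a basis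
  \<open>B\<close> of \<open>M\<close> identify \<open>W\<close> with the coordinate space of \<open>B\<close>, and the values of a vector of \<open>W\<close> on
  \<open>E i\<close> depend only on its values on \<open>B \<inter> E i\<close>. Hence cutting a vector of \<open>W\<close> down to its
  coordinates in \<open>E i\<close> stays inside \<open>W\<close> (\<open>coord_proj_summand_closed\<close>), so \<open>W\<close> splits, bases of the
  \<open>W \<inter> \<bbbK>\<^bsup>E i\<^esup>\<close> concatenate to a basis of \<open>W\<close>, and the resulting matrix is block diagonal for
  every basis of \<open>M\<close>. To avoid tracking the order of the columns, the squared minors are written as
  Gram determinants (\<open>gram_det_eq_minor_squared\<close>), which depend on the set of columns only.

  \<^emph>\<open>Irreducible implies connected.\<close> If \<open>M\<close> is a sum of two matroids on nonempty sets and has no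
  loops, both summands have positive rank, so the product formula exhibits \<open>\<psi>\<^sub>W\<close> as a product of two
  nonunits.
\<close>

section \<open>Factors of multilinear polynomials\<close>

definition multilinear :: "(('e \<Rightarrow>\<^sub>0 nat) \<Rightarrow>\<^sub>0 'k::zero) \<Rightarrow> bool" where
  "multilinear p \<longleftrightarrow> (\<forall>m\<in>Poly_Mapping.keys p. \<forall>e. Poly_Mapping.lookup m e \<le> 1)"

text \<open>
  The monomials of maximal degree in \<open>x\<^sub>e\<close>. A sum \<open>a + b\<close> of such monomials of \<open>A\<close> and of \<open>B\<close>
  has no representation by other monomials of \<open>A\<close> and \<open>B\<close>, because degrees in \<open>x\<^sub>e\<close> add up.
\<close>
definition top_in :: "'e \<Rightarrow> ('e \<Rightarrow>\<^sub>0 nat) set \<Rightarrow> ('e \<Rightarrow>\<^sub>0 nat) set" where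
  "top_in e A = {a \<in> A. \<forall>a'\<in>A. Poly_Mapping.lookup a' e \<le> Poly_Mapping.lookup a e}"

lemma top_in_nonempty:
  assumes "finite A" "A \<noteq> {}"
  shows "top_in e A \<noteq> {}"
proof -
  have "Max ((\<lambda>a. Poly_Mapping.lookup a e) ` A) \<in> (\<lambda>a. Poly_Mapping.lookup a e) ` A"
    using assms by (intro Max_in) auto
  then obtain a where "a \<in> A" "Poly_Mapping.lookup a e = Max ((\<lambda>a. Poly_Mapping.lookup a e) ` A)"
    by auto
  moreover have "Poly_Mapping.lookup a' e \<le> Max ((\<lambda>a. Poly_Mapping.lookup a e) ` A)" if "a' \<in> A" for a'
    using assms that by (intro Max_ge) auto
  ultimately have "a \<in> top_in e A"
    by (auto simp: top_in_def)
  thus ?thesis by blast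
qed

lemma top_in_subset: "top_in e A \<subseteq> A"
  by (auto simp: top_in_def)

lemma top_in_summands:
  assumes "a \<in> top_in e A" "b \<in> top_in e B" "a' \<in> A" "b' \<in> B" "a' + b' = a + b"
  shows "a' \<in> top_in e A \<and> b' \<in> top_in e B"
    and "Poly_Mapping.lookup a' e = Poly_Mapping.lookup a e"
    and "Poly_Mapping.lookup b' e = Poly_Mapping.lookup b e"
proof -
  have "Poly_Mapping.lookup a' e + Poly_Mapping.lookup b' e = Poly_Mapping.lookup a e + Poly_Mapping.lookup b e"
    using assms(5) by (metis lookup_add)
  moreover have "Poly_Mapping.lookup a' e \<le> Poly_Mapping.lookup a e"
      "Poly_Mapping.lookup b' e \<le> Poly_Mapping.lookup b e"
    using assms by (auto simp: top_in_def)
  ultimately show eq: "Poly_Mapping.lookup a' e = Poly_Mapping.lookup a e"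
      "Poly_Mapping.lookup b' e = Poly_Mapping.lookup b e"
    by linarith+
  show "a' \<in> top_in e A \<and> b' \<in> top_in e B"
    using assms eq by (auto simp: top_in_def)
qed

text \<open>
  Iterating \<^const>\<open>top_in\<close> over the variables picks lexicographic leading monomials without any
  order on the variables; their sum arises in only one way.
\<close>
lemma ex_sum_unique_on:
  fixes A B :: "('e \<Rightarrow>\<^sub>0 nat) set"
  assumes "finite F" "finite A" "A \<noteq> {}" "finite B" "B \<noteq> {}"
  shows "\<exists>a\<in>A. \<exists>b\<in>B. \<forall>a'\<in>A. \<forall>b'\<in>B. a' + b' = a + b \<longrightarrow>
           (\<forall>e\<in>F. Poly_Mapping.lookup a' e = Poly_Mapping.lookup a e \<and>
                   Poly_Mapping.lookup b' e = Poly_Mapping.lookup b e)"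
  using assms
proof (induction F arbitrary: A B rule: finite_induct)
  case empty
  then show ?case by (simp add: ex_in_conv)
next
  case (insert x F)
  have "\<exists>a\<in>top_in x A. \<exists>b\<in>top_in x B. \<forall>a'\<in>top_in x A. \<forall>b'\<in>top_in x B. a' + b' = a + b \<longrightarrow>
           (\<forall>e\<in>F. Poly_Mapping.lookup a' e = Poly_Mapping.lookup a e \<and>
                   Poly_Mapping.lookup b' e = Poly_Mapping.lookup b e)"
    by (intro insert.IH finite_subset[OF top_in_subset] top_in_nonempty insert.prems)
  then obtain a b where a: "a \<in> top_in x A" and b: "b \<in> top_in x B" and
    uniq: "\<forall>a'\<in>top_in x A. \<forall>b'\<in>top_in x B. a' + b' = a + b \<longrightarrow>
       (\<forall>e\<in>F. Poly_Mapping.lookup a' e = Poly_Mapping.lookup a e \<and>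
                   Poly_Mapping.lookup b' e = Poly_Mapping.lookup b e)"
    by (elim bexE)
  show ?case
  proof (rule bexI[of _ a], rule bexI[of _ b], intro ballI impI)
    fix a' b' e
    assume *: "a' \<in> A" "b' \<in> B" "a' + b' = a + b" and e: "e \<in> insert x F"
    note top = top_in_summands[OF a b *]
    show "Poly_Mapping.lookup a' e = Poly_Mapping.lookup a e \<and>
        Poly_Mapping.lookup b' e = Poly_Mapping.lookup b e"
    proof (cases "e = x")
      case True
      then show ?thesis using top(2,3) by simp
    next
      case False
      with e have "e \<in> F" by simp
      then show ?thesis
        by (rule uniq[rule_format, OF conjunct1[OF top(1)] conjunct2[OF top(1)] *(3)])
    qed
  qed (use a b in \<open>simp_all add: top_in_def\<close>)
qed

lemma lookup_mult_unique_sum: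
  fixes p q :: "'m::cancel_comm_monoid_add \<Rightarrow>\<^sub>0 'k::semiring_0"
  assumes "\<And>a' b'. a' \<in> Poly_Mapping.keys p \<Longrightarrow> b' \<in> Poly_Mapping.keys q \<Longrightarrow>
             a' + b' = a + b \<Longrightarrow> a' = a"
  shows "Poly_Mapping.lookup (p * q) (a + b) = Poly_Mapping.lookup p a * Poly_Mapping.lookup q b"
proof -
  have inner: "Poly_Mapping.lookup p l * (\<Sum>k. Poly_Mapping.lookup q k when a + b = l + k)
      = (Poly_Mapping.lookup p a * Poly_Mapping.lookup q b when l = a)" for l
  proof (cases "l = a")
    case True
    then show ?thesis by simp
  next
    case False
    have "Poly_Mapping.lookup p l * (\<Sum>k. Poly_Mapping.lookup q k when a + b = l + k) = 0"
    proof (cases "l \<in> Poly_Mapping.keys p")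
      case True
      have "(Poly_Mapping.lookup q k when a + b = l + k) = 0" for k
        using assms[OF True, of k] \<open>l \<noteq> a\<close> by (cases "Poly_Mapping.lookup q k = 0") (auto simp: when_def in_keys_iff)
      then show ?thesis by simp
    next
      case False
      then show ?thesis by (simp add: in_keys_iff)
    qed
    with False show ?thesis by simp
  qed
  show ?thesis
    unfolding lookup_mult inner by simp
qed

text \<open>
  This is additivity of the degree in \<open>x\<^sub>e\<close>: after restricting to monomials of top degree in
  \<open>x\<^sub>e\<close>, the uniquely represented sum cannot cancel in the product.
\<close>
lemma keys_mult_ex_maximal:
  fixes p q :: "('e::finite \<Rightarrow>\<^sub>0 nat) \<Rightarrow>\<^sub>0 'k::semiring_no_zero_divisors"
  assumes "Poly_Mapping.keys p \<noteq> {}" "Poly_Mapping.keys q \<noteq> {}"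
  shows "\<exists>a\<in>top_in e (Poly_Mapping.keys p). \<exists>b\<in>top_in e (Poly_Mapping.keys q).
           a + b \<in> Poly_Mapping.keys (p * q)"
proof -
  let ?A = "top_in e (Poly_Mapping.keys p)" and ?B = "top_in e (Poly_Mapping.keys q)"
  have "\<exists>a\<in>?A. \<exists>b\<in>?B. \<forall>a'\<in>?A. \<forall>b'\<in>?B. a' + b' = a + b \<longrightarrow>
           (\<forall>e\<in>UNIV. Poly_Mapping.lookup a' e = Poly_Mapping.lookup a e \<and>
                   Poly_Mapping.lookup b' e = Poly_Mapping.lookup b e)"
    using assms finite_subset[OF top_in_subset finite_keys] top_in_nonempty[OF finite_keys]
    by (intro ex_sum_unique_on) simp_all
  then obtain a b where a: "a \<in> ?A" and b: "b \<in> ?B" and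
    uniq: "\<forall>a'\<in>?A. \<forall>b'\<in>?B. a' + b' = a + b \<longrightarrow>
       (\<forall>e\<in>UNIV. Poly_Mapping.lookup a' e = Poly_Mapping.lookup a e \<and>
                   Poly_Mapping.lookup b' e = Poly_Mapping.lookup b e)"
    by (elim bexE)
  have "a' = a" if *: "a' \<in> Poly_Mapping.keys p" "b' \<in> Poly_Mapping.keys q" "a' + b' = a + b" for a' b'
    using uniq[rule_format, OF conjunct1 conjunct2, OF top_in_summands(1,1)[OF a b *] *(3)]
    by (intro poly_mapping_eqI) simp
  then have "Poly_Mapping.lookup (p * q) (a + b) = Poly_Mapping.lookup p a * Poly_Mapping.lookup q b"
    by (rule lookup_mult_unique_sum)
  moreover have "Poly_Mapping.lookup p a \<noteq> 0" "Poly_Mapping.lookup q b \<noteq> 0"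
    using a b top_in_subset[of e] in_keys_iff by blast+
  ultimately have "a + b \<in> Poly_Mapping.keys (p * q)"
    by (simp add: in_keys_iff)
  with a b show ?thesis by blast
qed

text \<open>
  A variable occurring in both factors would have degree at least two in the product.
\<close>
lemma multilinear_factors_disjoint:
  fixes p q :: "('e::finite \<Rightarrow>\<^sub>0 nat) \<Rightarrow>\<^sub>0 'k::semiring_no_zero_divisors"
  assumes "multilinear (p * q)" "a \<in> Poly_Mapping.keys p" "b \<in> Poly_Mapping.keys q"
  shows "Poly_Mapping.lookup a e = 0 \<or> Poly_Mapping.lookup b e = 0"
proof -
  have "Poly_Mapping.keys p \<noteq> {}" "Poly_Mapping.keys q \<noteq> {}"
    using assms(2,3) by auto
  then obtain a' b' where *: "a' \<in> top_in e (Poly_Mapping.keys p)" "b' \<in> top_in e (Poly_Mapping.keys q)"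
      "a' + b' \<in> Poly_Mapping.keys (p * q)"
    using keys_mult_ex_maximal[of p q e] by blast
  have "Poly_Mapping.lookup a' e + Poly_Mapping.lookup b' e \<le> 1"
    using *(3) assms(1) unfolding multilinear_def by (metis lookup_add)
  moreover have "Poly_Mapping.lookup a e \<le> Poly_Mapping.lookup a' e"
      "Poly_Mapping.lookup b e \<le> Poly_Mapping.lookup b' e"
    using * assms(2,3) by (auto simp: top_in_def)
  ultimately show ?thesis by linarith
qed

text \<open>
  As the factors share no variable, a product of monomials determines both of them, so no
  cancellation takes place.
\<close>
lemma keys_mult_multilinear:
  fixes p q :: "('e::finite \<Rightarrow>\<^sub>0 nat) \<Rightarrow>\<^sub>0 'k::semiring_no_zero_divisors"
  assumes "multilinear (p * q)" "a \<in> Poly_Mapping.keys p" "b \<in> Poly_Mapping.keys q"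
  shows "a + b \<in> Poly_Mapping.keys (p * q)"
proof -
  have "a' = a" if a': "a' \<in> Poly_Mapping.keys p" and b': "b' \<in> Poly_Mapping.keys q"
    and eq: "a' + b' = a + b" for a' b'
  proof (rule poly_mapping_eqI)
    fix e
    have "Poly_Mapping.lookup a' e + Poly_Mapping.lookup b' e = Poly_Mapping.lookup a e + Poly_Mapping.lookup b e"
      using eq by (metis lookup_add)
    moreover note multilinear_factors_disjoint[OF assms(1) a' b', of e]
      multilinear_factors_disjoint[OF assms(1) a' assms(3), of e]
      multilinear_factors_disjoint[OF assms(1) assms(2) b', of e]
      multilinear_factors_disjoint[OF assms(1-3), of e]
    ultimately show "Poly_Mapping.lookup a' e = Poly_Mapping.lookup a e"
      by linarith
  qed
  then have "Poly_Mapping.lookup (p * q) (a + b) = Poly_Mapping.lookup p a * Poly_Mapping.lookup q b"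
    by (rule lookup_mult_unique_sum)
  with assms(2,3) show ?thesis
    by (simp add: in_keys_iff)
qed

lemma constant_poly_dvd_one:
  fixes p :: "'m::comm_monoid_add \<Rightarrow>\<^sub>0 'k::field"
  assumes "Poly_Mapping.keys p \<subseteq> {0}" "p \<noteq> 0"
  shows "p dvd 1"
proof -
  have p: "p = Poly_Mapping.single 0 (Poly_Mapping.lookup p 0)"
    using assms(1) by (intro poly_mapping_eqI) (auto simp: lookup_single when_def in_keys_iff)
  with assms(2) have "Poly_Mapping.lookup p 0 \<noteq> 0"
    by (metis single_zero)
  then have "p * Poly_Mapping.single 0 (inverse (Poly_Mapping.lookup p 0)) = 1"
    by (subst p) (simp add: mult_single)
  then show ?thesis by (metis dvd_triv_left)
qed

section \<open>Bases and direct sums of matroids\<close>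

lemma indep_subset_ground: "matroid M \<Longrightarrow> S \<in> indep M \<Longrightarrow> S \<subseteq> ground M"
  by (simp add: matroid_def)

lemma indep_downward: "matroid M \<Longrightarrow> S \<in> indep M \<Longrightarrow> T \<subseteq> S \<Longrightarrow> T \<in> indep M"
  unfolding matroid_def by meson

lemma indep_extends_to_basis:
  assumes "matroid M" "S \<in> indep M"
  shows "\<exists>B. matroid_basis M B \<and> S \<subseteq> B"
proof -
  have "indep M \<subseteq> Pow (ground M)" "finite (ground M)"
    using assms(1) by (auto simp: matroid_def)
  then have "finite (indep M)"
    by (meson finite_Pow_iff finite_subset)
  then obtain B where B: "B \<in> indep M" "S \<subseteq> B" "\<And>T. T \<in> indep M \<Longrightarrow> B \<subseteq> T \<Longrightarrow> B = T"
    using finite_has_maximal2[OF _ assms(2)] by metis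
  then show ?thesis
    unfolding matroid_basis_def by metis
qed

lemma matroid_basis_exists:
  assumes "matroid M"
  shows "\<exists>B. matroid_basis M B"
  using indep_extends_to_basis[OF assms, of "{}"] assms by (auto simp: matroid_def)

lemma indep_subset_basis:
  assumes "matroid M" "matroid_basis M B" "S \<subseteq> B"
  shows "S \<in> indep M"
  using assms(2) indep_downward[OF assms(1) _ assms(3)] by (simp add: matroid_basis_def)

lemma matroid_basis_subset_ground:
  assumes "matroid M" "matroid_basis M B"
  shows "B \<subseteq> ground M"
  using assms(2) indep_subset_ground[OF assms(1)] by (simp add: matroid_basis_def)

lemma rank_pos_iff_nonempty_basis:
  assumes "matroid M"
  shows "matroid_rank M \<ge> 1 \<longleftrightarrow> (\<exists>B. matroid_basis M B \<and> B \<noteq> {})"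
proof -
  have sub: "indep M \<subseteq> Pow (ground M)" and fin: "finite (ground M)" and ne: "{} \<in> indep M"
    using assms by (auto simp: matroid_def)
  have "finite (indep M)"
    using sub fin by (meson finite_Pow_iff finite_subset)
  then have "matroid_rank M \<ge> 1 \<longleftrightarrow> (\<exists>S\<in>indep M. card S \<ge> 1)"
    unfolding matroid_rank_def using ne by (subst Max_ge_iff) auto
  also have "\<dots> \<longleftrightarrow> (\<exists>S\<in>indep M. S \<noteq> {})"
    using sub fin by (metis (no_types) One_nat_def Pow_iff Suc_leI card_eq_0_iff card_gt_0_iff
        finite_subset not_one_le_zero subsetD)
  also have "\<dots> \<longleftrightarrow> (\<exists>B. matroid_basis M B \<and> B \<noteq> {})"
    using indep_extends_to_basis[OF assms] unfolding matroid_basis_def by blast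
  finally show ?thesis .
qed

text \<open>
  The summands are the restrictions of \<open>M\<close> to \<open>P\<close> and to its complement. Independent sets
  of the two restrictions have an independent union because the bases that extend them
  can be recombined.
\<close>
lemma bases_split_imp_disconnected:
  assumes M: "matroid M" and P: "P \<subseteq> ground M" "P \<noteq> {}" "P \<noteq> ground M"
    and split: "\<And>B B'. matroid_basis M B \<Longrightarrow> matroid_basis M B' \<Longrightarrow>
                  matroid_basis M ((B \<inter> P) \<union> (B' - P))"
  shows "\<not> connected_matroid M"
proof -
  define side where "side b = (if b then P else ground M - P)" for b
  define N where "N b = \<lparr>ground = side b, indep = {S \<in> indep M. S \<subseteq> side b}\<rparr>" for b
  have "matroid (N b)" for b
    unfolding matroid_def
  proof (intro conjI ballI allI impI)
    show "finite (ground (N b))"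
      using M P(1) by (auto simp: N_def side_def matroid_def intro: finite_subset)
  next
    fix S T
    assume "S \<in> indep (N b)" "T \<in> indep (N b)" "card S < card T"
    then have ST: "S \<in> indep M" "T \<in> indep M" "S \<subseteq> side b" "T \<subseteq> side b" "card S < card T"
      by (auto simp: N_def)
    with M obtain e where "e \<in> T - S" "insert e S \<in> indep M"
      unfolding matroid_def by metis
    with ST show "\<exists>e\<in>T - S. insert e S \<in> indep (N b)"
      by (auto simp: N_def)
  qed (use M in \<open>auto simp: N_def matroid_def\<close>)
  moreover have "ground (N b) \<noteq> {}" for b
    using P by (auto simp: N_def side_def)
  moreover have "is_direct_sum M UNIV N"
    unfolding is_direct_sum_def
  proof (intro conjI)
    show "disjoint_family_on (\<lambda>i. ground (N i)) UNIV"
      by (auto simp: disjoint_family_on_def N_def side_def)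
    show "ground M = (\<Union>i\<in>UNIV. ground (N i))"
      using P(1) by (auto simp: N_def side_def UNIV_bool)
    show "indep M = {\<Union>i\<in>UNIV. S i |S. \<forall>i\<in>UNIV. S i \<in> indep (N i)}" (is "_ = ?R")
    proof (intro subset_antisym subsetI)
      fix T
      assume T: "T \<in> indep M"
      then have "T \<subseteq> ground M" and "\<And>S. S \<subseteq> T \<Longrightarrow> S \<in> indep M"
        using indep_subset_ground[OF M] indep_downward[OF M] by blast+
      then have "(\<Union>i. T \<inter> side i) = T" "\<forall>i. T \<inter> side i \<in> indep (N i)"
        by (auto simp: N_def side_def UNIV_bool)
      then show "T \<in> ?R"
        by (intro CollectI exI[of _ "\<lambda>i. T \<inter> side i"]) simp
    next
      fix T
      assume "T \<in> ?R"
      then obtain S where S: "T = (\<Union>i. S i)" "\<And>i. S i \<in> indep (N i)"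
        by auto
      have S_indep: "S True \<in> indep M" "S False \<in> indep M"
        and S_sub: "S True \<subseteq> P" "S False \<inter> P = {}"
        using S(2)[of True] S(2)[of False] by (auto simp: N_def side_def)
      obtain B B' where B: "matroid_basis M B" "S True \<subseteq> B" "matroid_basis M B'" "S False \<subseteq> B'"
        using indep_extends_to_basis[OF M] S_indep by metis
      have "T \<subseteq> (B \<inter> P) \<union> (B' - P)"
        unfolding S(1) UNIV_bool using B S_sub by auto
      then show "T \<in> indep M"
        using indep_subset_basis[OF M split[OF B(1,3)]] by blast
    qed
  qed
  ultimately show ?thesis
    unfolding connected_matroid_def by blast
qed

text \<open>
  A loop \<open>e\<close> separates: recombining two bases along \<open>{e}\<close> returns the second one.
\<close>
lemma connected_imp_no_loop:
  assumes M: "matroid M" "connected_matroid M" "matroid_rank M \<ge> 1"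
  shows "\<not> loop M e"
proof
  assume e: "loop M e"
  obtain B where "matroid_basis M B" "B \<noteq> {}"
    using M rank_pos_iff_nonempty_basis by blast
  then obtain x where "x \<in> B" "x \<in> ground M"
    using matroid_basis_subset_ground[OF M(1)] by blast
  moreover have "e \<notin> B"
    using e \<open>matroid_basis M B\<close> by (simp add: loop_def)
  ultimately have "{e} \<noteq> ground M"
    by auto
  moreover have "(B \<inter> {e}) \<union> (B' - {e}) = B'" if "matroid_basis M B" "matroid_basis M B'" for B B'
    using e that by (auto simp: loop_def)
  moreover have "{e} \<subseteq> ground M"
    using e by (simp add: loop_def)
  ultimately have "\<not> connected_matroid M"
    by (intro bases_split_imp_disconnected[OF M(1), of "{e}"]) simp_all
  with M(2) show False by blast
qed

lemma grounds_disjoint: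
  "is_direct_sum M I N \<Longrightarrow> i \<in> I \<Longrightarrow> j \<in> I \<Longrightarrow> i \<noteq> j \<Longrightarrow> ground (N i) \<inter> ground (N j) = {}"
  by (simp add: is_direct_sum_def disjoint_family_on_def)

context
  fixes M :: "'e pre_matroid" and I :: "'i set" and N :: "'i \<Rightarrow> 'e pre_matroid"
  assumes summands: "\<And>i. i \<in> I \<Longrightarrow> matroid (N i)" and sum: "is_direct_sum M I N"
begin

lemma union_inter_ground:
  assumes "\<And>i. i \<in> I \<Longrightarrow> S i \<subseteq> ground (N i)" "i \<in> I"
  shows "(\<Union>j\<in>I. S j) \<inter> ground (N i) = S i"
proof -
  have "S j \<inter> ground (N i) = (if j = i then S i else {})" if "j \<in> I" for j
    using assms(1)[OF that] grounds_disjoint[OF sum that assms(2)] by auto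
  then have "(\<Union>j\<in>I. S j \<inter> ground (N i)) = (\<Union>j\<in>I. if j = i then S i else {})"
    by simp
  then show ?thesis
    using assms(2) by (auto split: if_splits)
qed

lemma indep_iff_components:
  "T \<in> indep M \<longleftrightarrow> T \<subseteq> ground M \<and> (\<forall>i\<in>I. T \<inter> ground (N i) \<in> indep (N i))"
proof
  assume "T \<in> indep M"
  then have "T \<in> {\<Union>i\<in>I. S i |S. \<forall>i\<in>I. S i \<in> indep (N i)}"
    using sum by (simp add: is_direct_sum_def)
  then obtain S where S: "T = (\<Union>i\<in>I. S i)" "\<forall>i\<in>I. S i \<in> indep (N i)"
    by blast
  moreover have sub: "\<And>i. i \<in> I \<Longrightarrow> S i \<subseteq> ground (N i)"
    using S(2) indep_subset_ground[OF summands] by blast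
  moreover have "ground M = (\<Union>i\<in>I. ground (N i))"
    using sum by (simp add: is_direct_sum_def)
  ultimately show "T \<subseteq> ground M \<and> (\<forall>i\<in>I. T \<inter> ground (N i) \<in> indep (N i))"
    using union_inter_ground[of S] by auto
next
  assume *: "T \<subseteq> ground M \<and> (\<forall>i\<in>I. T \<inter> ground (N i) \<in> indep (N i))"
  moreover have "ground M = (\<Union>i\<in>I. ground (N i))"
    using sum by (simp add: is_direct_sum_def)
  ultimately have "T = (\<Union>i\<in>I. T \<inter> ground (N i))"
    by blast
  with * have "T \<in> {\<Union>i\<in>I. S i |S. \<forall>i\<in>I. S i \<in> indep (N i)}"
    by (intro CollectI exI[of _ "\<lambda>i. T \<inter> ground (N i)"]) simp
  then show "T \<in> indep M"
    using sum by (simp add: is_direct_sum_def)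
qed

lemma indep_component:
  assumes "i \<in> I"
  shows "S \<in> indep (N i) \<longleftrightarrow> S \<subseteq> ground (N i) \<and> S \<in> indep M"
proof
  assume S: "S \<in> indep (N i)"
  then have sub: "S \<subseteq> ground (N i)"
    by (rule indep_subset_ground[OF summands[OF assms]])
  have "S \<inter> ground (N j) = (if j = i then S else {})" if "j \<in> I" for j
    using sub grounds_disjoint[OF sum assms that] by auto
  moreover have "{} \<in> indep (N j)" if "j \<in> I" for j
    using summands[OF that] by (simp add: matroid_def)
  ultimately have "\<forall>j\<in>I. S \<inter> ground (N j) \<in> indep (N j)"
    using S by simp
  moreover have "S \<subseteq> ground M"
    using sub assms sum by (auto simp: is_direct_sum_def)
  ultimately show "S \<subseteq> ground (N i) \<and> S \<in> indep M"
    using sub indep_iff_components by blast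
next
  assume "S \<subseteq> ground (N i) \<and> S \<in> indep M"
  then show "S \<in> indep (N i)"
    using assms by (auto simp: indep_iff_components Int_absorb2)
qed

lemma basis_component:
  assumes B: "matroid_basis M B" and i: "i \<in> I"
  shows "matroid_basis (N i) (B \<inter> ground (N i))"
  unfolding matroid_basis_def
proof (intro conjI ballI impI)
  show "B \<inter> ground (N i) \<in> indep (N i)"
    using B i by (auto simp: matroid_basis_def indep_iff_components)
  fix S
  assume S: "S \<in> indep (N i)" "B \<inter> ground (N i) \<subseteq> S"
  have S_sub: "S \<subseteq> ground (N i)" "S \<subseteq> ground M"
    using S(1) by (simp_all add: indep_component[OF i] indep_iff_components)
  have "(B \<union> S) \<inter> ground (N j) = (if j = i then S else B \<inter> ground (N j))" if "j \<in> I" for j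
    using S(2) S_sub grounds_disjoint[OF sum i that] by auto
  then have "B \<union> S \<in> indep M"
    using B S(1) S_sub(2) by (auto simp: matroid_basis_def indep_iff_components)
  then have "B \<union> S = B"
    using B by (simp add: matroid_basis_def)
  then show "S = B \<inter> ground (N i)"
    using S(2) S_sub(1) by blast
qed

lemma basis_eq_union_components:
  assumes "matroid_basis M B"
  shows "B = (\<Union>i\<in>I. B \<inter> ground (N i))"
  using assms sum by (auto simp: matroid_basis_def indep_iff_components is_direct_sum_def)

lemma union_bases:
  assumes "\<And>i. i \<in> I \<Longrightarrow> matroid_basis (N i) (S i)"
  shows "matroid_basis M (\<Union>i\<in>I. S i)"
  unfolding matroid_basis_def
proof (intro conjI ballI impI)
  have S_sub: "\<And>i. i \<in> I \<Longrightarrow> S i \<subseteq> ground (N i)"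
    by (rule matroid_basis_subset_ground[OF summands assms])
  note inter = union_inter_ground[of S, OF S_sub]
  show "(\<Union>i\<in>I. S i) \<in> indep M"
    using S_sub sum assms by (auto simp: indep_iff_components inter is_direct_sum_def matroid_basis_def)
  fix T
  assume T: "T \<in> indep M" "(\<Union>i\<in>I. S i) \<subseteq> T"
  have "T \<inter> ground (N i) = S i" if "i \<in> I" for i
  proof -
    have "T \<inter> ground (N i) \<in> indep (N i)"
      using T(1) that by (simp add: indep_iff_components)
    moreover have "S i \<subseteq> T \<inter> ground (N i)"
      using T(2) S_sub[OF that] that by blast
    ultimately show ?thesis
      using assms[OF that] by (simp add: matroid_basis_def)
  qed
  moreover have "T = (\<Union>i\<in>I. T \<inter> ground (N i))"
    using T(1) sum by (auto simp: indep_iff_components is_direct_sum_def)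
  ultimately show "T = (\<Union>i\<in>I. S i)"
    by simp
qed

lemma bases_bij_betw_families:
  "bij_betw (\<lambda>S. \<Union>i\<in>I. S i) (\<Pi>\<^sub>E i\<in>I. {B. matroid_basis (N i) B}) {B. matroid_basis M B}"
proof (rule bij_betw_byWitness[where f' = "\<lambda>B. \<lambda>i\<in>I. B \<inter> ground (N i)"])
  show "\<forall>S\<in>\<Pi>\<^sub>E i\<in>I. {B. matroid_basis (N i) B}. (\<lambda>i\<in>I. (\<Union>i\<in>I. S i) \<inter> ground (N i)) = S"
  proof
    fix S
    assume S: "S \<in> (\<Pi>\<^sub>E i\<in>I. {B. matroid_basis (N i) B})"
    then have "S i \<subseteq> ground (N i)" if "i \<in> I" for i
      using that by (intro matroid_basis_subset_ground[OF summands]) (auto simp: PiE_iff)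
    then show "(\<lambda>i\<in>I. (\<Union>i\<in>I. S i) \<inter> ground (N i)) = S"
      using union_inter_ground S by (intro PiE_ext[OF _ S]) (auto simp: PiE_iff)
  qed
  show "\<forall>B\<in>{B. matroid_basis M B}. (\<Union>i\<in>I. (\<lambda>i\<in>I. B \<inter> ground (N i)) i) = B"
    using basis_eq_union_components by auto
  show "(\<lambda>S. \<Union>i\<in>I. S i) ` (\<Pi>\<^sub>E i\<in>I. {B. matroid_basis (N i) B}) \<subseteq> {B. matroid_basis M B}"
    using union_bases by (auto simp: PiE_iff)
  show "(\<lambda>B. \<lambda>i\<in>I. B \<inter> ground (N i)) ` {B. matroid_basis M B}
      \<subseteq> (\<Pi>\<^sub>E i\<in>I. {B. matroid_basis (N i) B})"
    using basis_component by auto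
qed

end

section \<open>Realizations: bases and maximal minors\<close>

lemma enumeration_props: "distinct (enumeration B)" "set (enumeration B) = (B :: 'e::finite set)"
proof -
  have "\<exists>es. distinct es \<and> set es = B"
    using finite_distinct_list[of B] by auto
  then have "distinct (enumeration B) \<and> set (enumeration B) = B"
    unfolding enumeration_def by (rule someI_ex)
  then show "distinct (enumeration B)" "set (enumeration B) = B"
    by auto
qed

lemma length_enumeration: "length (enumeration B) = card (B :: 'e::finite set)"
  using enumeration_props[of B] distinct_card by metis

lemma sum_distinct_list: "distinct es \<Longrightarrow> (\<Sum>e\<in>set es. f e) = (\<Sum>j<length es. f (es ! j))"
  using sum.reindex_bij_betw[OF bij_betw_nth[of es "{..<length es}" "set es"], of f] by simp

lemma ordered_basisI:
  fixes W :: "('k::field ^ 'e::finite) set"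
  assumes "set ws \<subseteq> W" "W \<subseteq> vec.span (set ws)" "vec.subspace W" "length ws \<le> vec.dim W"
  shows "ordered_basis W ws"
proof -
  have "vec.dim W \<le> card (set ws)"
    using assms(2) by (intro vec.dim_le_card) auto
  with assms(4) card_length[of ws] have card: "card (set ws) = length ws" "card (set ws) \<le> vec.dim W"
    by auto
  then have "vec.independent (set ws)"
    using assms(1,2) by (intro vec.card_le_dim_spanning) auto
  moreover have "vec.span (set ws) = W"
    using assms(1-3) by (simp add: vec.span_minimal subset_antisym)
  ultimately show ?thesis
    using card(1) by (simp add: ordered_basis_def card_distinct)
qed

lemma length_ordered_basis:
  assumes "ordered_basis W ws"
  shows "length ws = vec.dim W"
proof -
  have ws: "distinct ws" "vec.independent (set ws)" "vec.span (set ws) = W"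
    using assms by (auto simp: ordered_basis_def)
  have "vec.dim W = vec.dim (set ws)"
    using vec.dim_span[of "set ws"] ws(3) by metis
  also have "\<dots> = card (set ws)"
    by (rule vec.dim_eq_card_independent[OF ws(2)])
  finally show ?thesis
    using ws(1) by (simp add: distinct_card)
qed

definition coord_proj :: "'e set \<Rightarrow> 'k::field ^ 'e \<Rightarrow> 'k ^ 'e" where
  "coord_proj F v = (\<chi> e. if e \<in> F then v $ e else 0)"

lemma coord_proj_nth [simp]: "coord_proj F v $ e = (if e \<in> F then v $ e else 0)"
  by (simp add: coord_proj_def)

lemma linear_coord_proj: "Vector_Spaces.linear (*s) (*s) (coord_proj F)"
  by (simp add: Vector_Spaces.linear_iff vec.vector_space_axioms Finite_Cartesian_Product.vec_eq_iff)

lemma coord_proj_in_coord_space: "coord_proj F v \<in> coord_space F"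
  by (simp add: coord_space_def)

lemma dim_coord_space: "vec.dim (coord_space F :: ('k::field ^ 'e::finite) set) = card F"
  unfolding coord_space_def by (rule dim_substandard_cart)

lemma subspace_coord_space: "vec.subspace (coord_space F)"
  by (auto simp: vec.subspace_def coord_space_def)

text \<open>
  Evaluating a linear relation on \<open>insert f S\<close> at \<open>w\<close> isolates the coefficient of \<open>f\<close>.
\<close>
lemma coords_independent_insert:
  fixes W :: "('k::field ^ 'e::finite) set"
  assumes S: "coords_independent W S" and w: "w \<in> W" "\<forall>e\<in>S. w $ e = 0" "w $ f \<noteq> 0"
  shows "coords_independent W (insert f S)"
  unfolding coords_independent_def
proof (intro allI impI)
  fix c :: "'e \<Rightarrow> 'k"
  assume c: "\<forall>w\<in>W. (\<Sum>e\<in>insert f S. c e * w $ e) = 0"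
  have "f \<notin> S" using w by auto
  then have split: "(\<Sum>e\<in>insert f S. c e * u $ e) = c f * u $ f + (\<Sum>e\<in>S. c e * u $ e)" for u
    by simp
  have "(\<Sum>e\<in>S. c e * w $ e) = 0"
    using w(2) by simp
  with c w split[of w] have cf: "c f = 0" by simp
  with c have "\<forall>w\<in>W. (\<Sum>e\<in>S. c e * w $ e) = 0"
    unfolding split by simp
  with S have "\<forall>e\<in>S. c e = 0"
    unfolding coords_independent_def by blast
  with cf show "\<forall>e\<in>insert f S. c e = 0" by simp
qed

lemma coordinate_vanishes:
  assumes W: "realizes W M" and S: "S \<in> indep M"
    and w: "w \<in> W" "\<forall>e\<in>S. w $ e = 0" and f: "f \<in> ground M" "f \<notin> S \<Longrightarrow> insert f S \<notin> indep M"
  shows "w $ f = 0"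
proof (rule ccontr)
  assume nz: "w $ f \<noteq> 0"
  have "coords_independent W S" "S \<subseteq> ground M"
    using W S by (auto simp: realizes_def)
  then have "insert f S \<in> indep M"
    using W coords_independent_insert[OF _ w nz] f(1) by (simp add: realizes_def)
  with f(2) w(2) nz show False by blast
qed

lemma vector_determined_by_basis:
  assumes W: "realizes W M" and B: "matroid_basis M B" and w: "w \<in> W" "\<forall>e\<in>B. w $ e = 0"
  shows "w = 0"
proof -
  have "w $ f = 0" for f
  proof (cases "f \<in> ground M")
    case True
    show ?thesis
    proof (rule coordinate_vanishes[OF W _ w True])
      show "B \<in> indep M"
        using B by (simp add: matroid_basis_def)
      show "insert f B \<notin> indep M" if "f \<notin> B"
        using B that unfolding matroid_basis_def by blast
    qed
  next
    case False
    then show ?thesis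
      using W w(1) by (auto simp: realizes_def coord_space_def)
  qed
  then show ?thesis by (simp add: Finite_Cartesian_Product.vec_eq_iff)
qed

lemma inj_on_coord_proj_basis:
  assumes W: "realizes W M" and B: "matroid_basis M B"
  shows "inj_on (coord_proj B) W"
proof (rule inj_onI)
  fix x y
  assume xy: "x \<in> W" "y \<in> W" "coord_proj B x = coord_proj B y"
  have "x - y \<in> W"
    using W xy by (simp add: realizes_def vec.subspace_diff)
  moreover have "\<forall>e\<in>B. (x - y) $ e = 0"
  proof
    fix e
    assume "e \<in> B"
    then show "(x - y) $ e = 0"
      using arg_cong[OF xy(3), of "\<lambda>v. v $ e"] by simp
  qed
  ultimately have "x - y = 0"
    by (rule vector_determined_by_basis[OF W B])
  then show "x = y" by simp
qed

lemma dim_coord_proj_basis: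
  assumes W: "realizes W M" and B: "matroid_basis M B"
  shows "vec.dim (coord_proj B ` W) = vec.dim W"
proof (rule vec.dim_image_eq[OF linear_coord_proj])
  have "vec.span W = W"
    using W by (simp add: realizes_def)
  then show "inj_on (coord_proj B) (vec.span W)"
    using inj_on_coord_proj_basis[OF W B] by metis
qed

lemma det_zero_row:
  fixes A :: "'k::comm_ring_1 mat"
  assumes A: "A \<in> carrier_mat n n" and k: "k < n" "\<And>j. j < n \<Longrightarrow> A $$ (k, j) = 0"
  shows "Determinant.det A = 0"
proof -
  have "multrow k 0 A = A"
    using A k by (intro eq_matI) auto
  then show ?thesis
    using det_multrow[OF k(1) A, of 0] by simp
qed

text \<open>
  A kernel vector of the matrix is a linear relation between the coordinates on the rows \<open>ws\<close>,
  hence on their span. The rows of zeros make the matrix square before it is known that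
  \<open>ws\<close> and \<open>es\<close> have the same length; once the minor is known to be nonzero there can be no
  such row.
\<close>
lemma padded_minor_nonzero:
  fixes ws :: "('k::field ^ 'e::finite) list"
  assumes es: "distinct es" "coords_independent (vec.span (set ws)) (set es)"
    and len: "length ws \<le> length es"
  shows "Determinant.det (Matrix.mat (length es) (length es)
           (\<lambda>(i, j). if i < length ws then ws ! i $ (es ! j) else 0)) \<noteq> 0"
    (is "Determinant.det ?A \<noteq> 0")
proof
  let ?n = "length es"
  have A: "?A \<in> carrier_mat ?n ?n" by simp
  assume "Determinant.det ?A = 0"
  then obtain v where v: "v \<in> carrier_vec ?n" "v \<noteq> 0\<^sub>v ?n" "?A *\<^sub>v v = 0\<^sub>v ?n"
    using det_0_iff_vec_prod_zero_field[OF A] by blast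
  define c where "c e = vec_index v (inv_into {..<?n} ((!) es) e)" for e
  have inj: "inj_on ((!) es) {..<?n}"
    using es(1) by (simp add: inj_on_nth)
  have c_nth: "c (es ! j) = vec_index v j" if "j < ?n" for j
    using that inj by (simp add: c_def inv_into_f_f)
  have combination: "(\<Sum>e\<in>set es. c e * w $ e) = (\<Sum>j<?n. w $ (es ! j) * vec_index v j)" for w :: "'k ^ 'e"
    unfolding sum_distinct_list[OF es(1)] by (intro sum.cong) (simp_all add: c_nth mult.commute)
  let ?U = "{w :: 'k ^ 'e. (\<Sum>e\<in>set es. c e * w $ e) = 0}"
  have "vec.subspace ?U"
    by (auto simp: vec.subspace_def algebra_simps sum.distrib sum_distrib_left[symmetric] mult.left_commute)
  moreover have "set ws \<subseteq> ?U"
  proof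
    fix w
    assume "w \<in> set ws"
    then obtain i where i: "i < length ws" "w = ws ! i"
      by (metis in_set_conv_nth)
    have "vec_index (?A *\<^sub>v v) i = 0"
      using v(3) i(1) len by simp
    then have "(\<Sum>j<?n. w $ (es ! j) * vec_index v j) = 0"
      using v(1) i len by (simp add: scalar_prod_def lessThan_atLeast0)
    then show "w \<in> ?U"
      by (simp add: combination)
  qed
  ultimately have "vec.span (set ws) \<subseteq> ?U"
    by (simp add: vec.span_minimal)
  then have "\<forall>e\<in>set es. c e = 0"
    using es(2) unfolding coords_independent_def by auto
  then have "vec_index v j = 0" if "j < ?n" for j
    using c_nth[OF that] nth_mem[OF that] by metis
  then have "v = 0\<^sub>v ?n"
    using v(1) by (intro eq_vecI) auto
  with v(2) show False by blast
qed

text \<open>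
  The coordinates in a basis are injective on \<open>W\<close>, so there are at least \<open>dim W\<close> of them;
  with more than that, the padded minor would contain a row of zeros.
\<close>
lemma basis_card_and_minor:
  fixes W :: "('k::field ^ 'e::finite) set"
  assumes W: "realizes W M" and ws: "ordered_basis W ws" and B: "matroid_basis M B"
  shows card_basis_eq_length: "card B = length ws" and maximal_minor_nonzero: "maximal_minor ws B \<noteq> 0"
proof -
  let ?es = "enumeration B"
  let ?A = "Matrix.mat (card B) (card B) (\<lambda>(i, j). if i < length ws then ws ! i $ (?es ! j) else 0)"
  have span: "vec.span (set ws) = W"
    using ws by (simp add: ordered_basis_def)
  have "vec.dim W \<le> vec.dim (coord_space B :: ('k ^ 'e) set)"
    unfolding dim_coord_proj_basis[OF W B, symmetric]
    using coord_proj_in_coord_space by (intro vec.dim_subset) blast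
  then have le: "length ws \<le> card B"
    by (simp add: dim_coord_space length_ordered_basis[OF ws])
  have "coords_independent W B"
    using W B by (simp add: realizes_def matroid_basis_def)
  then have nz: "Determinant.det ?A \<noteq> 0"
    using padded_minor_nonzero[of ?es ws] le span by (simp add: enumeration_props length_enumeration)
  show card: "card B = length ws"
  proof (rule ccontr)
    assume "card B \<noteq> length ws"
    with le have "Determinant.det ?A = 0"
      by (intro det_zero_row[of _ "card B" "length ws"]) auto
    with nz show False by blast
  qed
  have "?A = Matrix.mat (length ws) (length ws) (\<lambda>(i, j). ws ! i $ (?es ! j))"
    unfolding card by (intro eq_matI) auto
  with nz show "maximal_minor ws B \<noteq> 0"
    by (simp add: maximal_minor_def)
qed

lemma ex_ordered_basis:
  assumes "vec.subspace W"
  shows "\<exists>ws. ordered_basis W ws"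
  using ex_is_config_poly[OF assms] by (auto simp: is_config_poly_def)

lemma card_basis_eq_dim:
  assumes W: "realizes W M" and B: "matroid_basis M B"
  shows "card B = vec.dim W"
proof -
  obtain ws where ws: "ordered_basis W ws"
    using ex_ordered_basis[of W] W by (auto simp: realizes_def)
  show ?thesis
    using card_basis_eq_length[OF W ws B] length_ordered_basis[OF ws] by simp
qed

lemma ex_vector_with_basis_coords:
  fixes x :: "'k::field ^ 'e::finite"
  assumes W: "realizes W M" and B: "matroid_basis M B"
  shows "\<exists>w\<in>W. \<forall>e\<in>B. w $ e = x $ e"
proof -
  have "coord_proj B ` W = coord_space B"
  proof (rule vec.subspace_dim_equal)
    show "vec.subspace (coord_proj B ` W)"
      using W by (intro vec.linear_subspace_image[OF linear_coord_proj]) (simp add: realizes_def)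
    show "coord_proj B ` W \<subseteq> coord_space B"
      using coord_proj_in_coord_space by blast
    show "vec.dim (coord_space B :: ('k ^ 'e) set) \<le> vec.dim (coord_proj B ` W)"
      by (simp add: dim_coord_space dim_coord_proj_basis[OF W B] card_basis_eq_dim[OF W B])
  qed (rule subspace_coord_space)
  then have "coord_proj B x \<in> coord_proj B ` W"
    using coord_proj_in_coord_space by blast
  then obtain w where w: "w \<in> W" "coord_proj B x = coord_proj B w" by blast
  have "\<forall>e\<in>B. w $ e = x $ e"
  proof
    fix e
    assume "e \<in> B"
    then show "w $ e = x $ e"
      using arg_cong[OF w(2), of "\<lambda>v. v $ e"] by simp
  qed
  with w(1) show ?thesis by blast
qed

section \<open>Realizations of direct sums\<close>

context
  fixes M :: "'e::finite pre_matroid" and I :: "'i set" and N :: "'i \<Rightarrow> 'e pre_matroid"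
    and W :: "('k::field ^ 'e) set"
  assumes M: "matroid M" and summands: "\<And>i. i \<in> I \<Longrightarrow> matroid (N i)"
    and sum: "is_direct_sum M I N" and W: "realizes W M"
begin

text \<open>
  Take the vector \<open>w'\<close> of \<open>W\<close> that agrees on a basis \<open>B\<close> with \<open>w\<close> cut down to \<open>E i = ground (N i)\<close>.
  A vector of \<open>W\<close> that vanishes on \<open>B \<inter> E j\<close> vanishes on all of \<open>E j\<close>, since \<open>B \<inter> E j\<close> is a basis
  of \<open>N j\<close>. For \<open>j = i\<close>, applied to \<open>w' - w\<close>, and for \<open>j \<noteq> i\<close>, applied to \<open>w'\<close>, this identifies
  \<open>w'\<close> with the cut down vector.
\<close>
lemma coord_proj_summand_closed:
  assumes w: "w \<in> W" and i: "i \<in> I"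
  shows "coord_proj (ground (N i)) w \<in> W"
proof -
  let ?x = "coord_proj (ground (N i)) w"
  obtain B where B: "matroid_basis M B"
    using matroid_basis_exists[OF M] by blast
  have vanish: "u $ f = 0"
    if u: "u \<in> W" "\<forall>e\<in>B \<inter> ground (N j). u $ e = 0" and j: "j \<in> I" and f: "f \<in> ground (N j)" for u j f
  proof (rule coordinate_vanishes[OF W _ u])
    have Bj: "matroid_basis (N j) (B \<inter> ground (N j))"
      by (rule basis_component[OF summands sum B j])
    then show "B \<inter> ground (N j) \<in> indep M"
      by (simp add: matroid_basis_def indep_component[OF summands sum j])
    show "f \<in> ground M"
      using f j sum by (auto simp: is_direct_sum_def)
    show "insert f (B \<inter> ground (N j)) \<notin> indep M" if "f \<notin> B \<inter> ground (N j)"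
    proof
      assume "insert f (B \<inter> ground (N j)) \<in> indep M"
      then have "insert f (B \<inter> ground (N j)) \<in> indep (N j)"
        using f by (simp add: indep_component[OF summands sum j])
      then have "insert f (B \<inter> ground (N j)) = B \<inter> ground (N j)"
        using Bj by (simp add: matroid_basis_def subset_insertI)
      with that show False by blast
    qed
  qed
  obtain w' where w': "w' \<in> W" "\<forall>e\<in>B. w' $ e = ?x $ e"
    using ex_vector_with_basis_coords[OF W B, of ?x] by blast
  have "w' $ f = ?x $ f" for f
  proof (cases "f \<in> ground M")
    case False
    then have "f \<notin> ground (N i)"
      using i sum by (auto simp: is_direct_sum_def)
    moreover have "w' $ f = 0"
      using W w'(1) False by (auto simp: realizes_def coord_space_def)
    ultimately show ?thesis by simp
  next
    case True
    then obtain j where j: "j \<in> I" "f \<in> ground (N j)"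
      using sum by (auto simp: is_direct_sum_def)
    show ?thesis
    proof (cases "j = i")
      case True
      have "w' - w \<in> W"
        using W w w'(1) by (simp add: realizes_def vec.subspace_diff)
      moreover have "\<forall>e\<in>B \<inter> ground (N i). (w' - w) $ e = 0"
        using w'(2) by simp
      ultimately have "(w' - w) $ f = 0"
        using vanish i j(2) True by blast
      with True j(2) show ?thesis by simp
    next
      case False
      then have disj: "ground (N j) \<inter> ground (N i) = {}"
        using grounds_disjoint[OF sum j(1) i] by simp
      have "\<forall>e\<in>B \<inter> ground (N j). w' $ e = 0"
      proof
        fix e
        assume e: "e \<in> B \<inter> ground (N j)"
        with disj have "e \<notin> ground (N i)" by blast
        with w'(2) e show "w' $ e = 0" by simp
      qed
      then have "w' $ f = 0"
        using vanish w'(1) j by blast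
      moreover have "f \<notin> ground (N i)"
        using disj j(2) by blast
      ultimately show ?thesis by simp
    qed
  qed
  then have "w' = ?x"
    by (simp add: Finite_Cartesian_Product.vec_eq_iff)
  with w'(1) show ?thesis by simp
qed

text \<open>
  A linear relation between coordinates in \<open>E i\<close> does not distinguish a vector of \<open>W\<close> from its part
  in \<open>E i\<close>, which lies in \<open>W\<close> as well.
\<close>
lemma realizes_summand:
  assumes i: "i \<in> I"
  shows "realizes (W \<inter> coord_space (ground (N i))) (N i)"
proof -
  let ?V = "W \<inter> coord_space (ground (N i))"
  have "coords_independent W S \<longleftrightarrow> coords_independent ?V S" if S: "S \<subseteq> ground (N i)" for S
  proof -
    have "(\<forall>w\<in>W. (\<Sum>e\<in>S. c e * w $ e) = 0) \<longleftrightarrow> (\<forall>w\<in>?V. (\<Sum>e\<in>S. c e * w $ e) = 0)" for c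
    proof (intro iffI ballI)
      fix w
      assume V: "\<forall>w\<in>?V. (\<Sum>e\<in>S. c e * w $ e) = 0" and w: "w \<in> W"
      have "(\<Sum>e\<in>S. c e * w $ e) = (\<Sum>e\<in>S. c e * coord_proj (ground (N i)) w $ e)"
        using S by (intro sum.cong) auto
      also have "\<dots> = 0"
        using V coord_proj_summand_closed[OF w i] coord_proj_in_coord_space by blast
      finally show "(\<Sum>e\<in>S. c e * w $ e) = 0" .
    qed blast
    then show ?thesis
      by (simp add: coords_independent_def)
  qed
  moreover have "ground (N i) \<subseteq> ground M"
    using i sum by (auto simp: is_direct_sum_def)
  ultimately have "indep (N i) = {S. S \<subseteq> ground (N i) \<and> coords_independent ?V S}"
    using W by (auto simp: indep_component[OF summands sum i] realizes_def)
  moreover have "vec.subspace ?V"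
    using W by (simp add: realizes_def vec.subspace_inter subspace_coord_space)
  ultimately show ?thesis
    by (simp add: realizes_def)
qed

text \<open>
  Spanning holds because each vector of \<open>W\<close> is the sum of its parts. Independence
  is then a matter of counting: the lengths add up to the size of a basis of \<open>M\<close>.
\<close>
lemma ordered_basis_concat:
  assumes xs: "distinct xs" "set xs = I"
    and ws: "\<And>i. i \<in> I \<Longrightarrow> ordered_basis (W \<inter> coord_space (ground (N i))) (ws i)"
  shows "ordered_basis W (concat (map ws xs))"
proof (rule ordered_basisI)
  let ?V = "\<lambda>i. W \<inter> coord_space (ground (N i))"
  have fin: "finite I" using xs(2) by auto
  have span: "vec.span (set (ws i)) = ?V i" if "i \<in> I" for i
    using ws[OF that] by (simp add: ordered_basis_def)
  show "set (concat (map ws xs)) \<subseteq> W"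
    using span vec.span_superset xs(2) by fastforce
  show "W \<subseteq> vec.span (set (concat (map ws xs)))"
  proof
    fix w
    assume w: "w \<in> W"
    have "w = (\<Sum>i\<in>I. coord_proj (ground (N i)) w)"
    proof (subst Finite_Cartesian_Product.vec_eq_iff, intro allI)
      fix f
      show "w $ f = (\<Sum>i\<in>I. coord_proj (ground (N i)) w) $ f"
      proof (cases "f \<in> ground M")
        case False
        then have "w $ f = 0" "\<forall>i\<in>I. f \<notin> ground (N i)"
          using W w sum by (auto simp: realizes_def coord_space_def is_direct_sum_def)
        then show ?thesis by simp
      next
        case True
        then obtain j where j: "j \<in> I" "f \<in> ground (N j)"
          using sum by (auto simp: is_direct_sum_def)
        have "(\<Sum>i\<in>I. coord_proj (ground (N i)) w $ f) = (\<Sum>i\<in>I. if i = j then w $ f else 0)"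
          using j grounds_disjoint[OF sum j(1)] by (intro sum.cong) auto
        then show ?thesis
          using fin j(1) by simp
      qed
    qed
    also have "\<dots> \<in> vec.span (set (concat (map ws xs)))"
    proof (rule vec.span_sum)
      fix i
      assume i: "i \<in> I"
      then have "coord_proj (ground (N i)) w \<in> vec.span (set (ws i))"
        using coord_proj_summand_closed[OF w i] coord_proj_in_coord_space by (auto simp: span)
      also have "\<dots> \<subseteq> vec.span (set (concat (map ws xs)))"
        using i xs(2) by (intro vec.span_mono) auto
      finally show "coord_proj (ground (N i)) w \<in> vec.span (set (concat (map ws xs)))" .
    qed
    finally show "w \<in> vec.span (set (concat (map ws xs)))" .
  qed
  show "vec.subspace W"
    using W by (simp add: realizes_def)
  show "length (concat (map ws xs)) \<le> vec.dim W"
  proof -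
    obtain B where B: "matroid_basis M B"
      using matroid_basis_exists[OF M] by blast
    have "length (concat (map ws xs)) = (\<Sum>i\<in>I. length (ws i))"
      using xs by (simp add: length_concat sum_list_distinct_conv_sum_set comp_def)
    also have "\<dots> = (\<Sum>i\<in>I. card (B \<inter> ground (N i)))"
    proof (rule sum.cong)
      fix i
      assume i: "i \<in> I"
      show "length (ws i) = card (B \<inter> ground (N i))"
        using card_basis_eq_length[OF realizes_summand[OF i] ws[OF i] basis_component[OF summands sum B i]]
        by simp
    qed simp
    also have "\<dots> = card (\<Union>i\<in>I. B \<inter> ground (N i))"
      using fin grounds_disjoint[OF sum] by (intro card_UN_disjoint[symmetric]) auto
    also have "\<dots> = card B"
      using basis_eq_union_components[OF summands sum B] by simp
    also have "\<dots> = vec.dim W"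
      by (rule card_basis_eq_dim[OF W B])
    finally show ?thesis by simp
  qed
qed

end

section \<open>The product formula\<close>

text \<open>
  For \<open>card B = length ws\<close> this is \<open>det (A A\<^sup>T)\<close>, where \<open>A\<close> consists of the columns of \<open>ws\<close>
  in \<open>B\<close>; unlike \<^const>\<open>maximal_minor\<close> it involves no enumeration of \<open>B\<close>.
\<close>
definition gram_det :: "('k::field ^ 'e) list \<Rightarrow> 'e set \<Rightarrow> 'k" where
  "gram_det ws B = Determinant.det (Matrix.mat (length ws) (length ws)
     (\<lambda>(i, k). \<Sum>e\<in>B. ws ! i $ e * ws ! k $ e))"

lemma gram_det_eq_minor_squared:
  fixes ws :: "('k::field ^ 'e::finite) list"
  assumes "card B = length ws"
  shows "gram_det ws B = (maximal_minor ws B)\<^sup>2"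
proof -
  let ?n = "length ws"
  let ?A = "Matrix.mat ?n ?n (\<lambda>(i, j). ws ! i $ (enumeration B ! j))"
  let ?G = "Matrix.mat ?n ?n (\<lambda>(i, k). \<Sum>e\<in>B. ws ! i $ e * ws ! k $ e)"
  have A: "?A \<in> carrier_mat ?n ?n" by simp
  have entry: "(\<Sum>e\<in>B. f e) = (\<Sum>j\<in>{0..<?n}. f (enumeration B ! j))" for f :: "'e \<Rightarrow> 'k"
    using sum_distinct_list[OF enumeration_props(1)[of B], of f] assms
    by (simp add: enumeration_props length_enumeration lessThan_atLeast0)
  have "?G = ?A * transpose_mat ?A"
    by (rule eq_matI) (simp_all add: scalar_prod_def entry)
  then have "Determinant.det ?G = Determinant.det ?A * Determinant.det ?A"
    using det_mult[OF A, of "transpose_mat ?A"] det_transpose[OF A] by simp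
  then show ?thesis
    by (simp add: gram_det_def maximal_minor_def power2_eq_square)
qed

text \<open>
  The Gram matrix is block diagonal: each list vanishes on the columns of the other one.
\<close>
lemma gram_det_append:
  fixes ws1 ws2 :: "('k::field ^ 'e::finite) list"
  assumes ws: "set ws1 \<subseteq> coord_space E1" "set ws2 \<subseteq> coord_space E2"
    and B: "B1 \<subseteq> E1" "B2 \<subseteq> E2" and disj: "E1 \<inter> E2 = {}"
  shows "gram_det (ws1 @ ws2) (B1 \<union> B2) = gram_det ws1 B1 * gram_det ws2 B2"
proof -
  let ?n = "length ws1" and ?m = "length ws2"
  let ?G1 = "Matrix.mat ?n ?n (\<lambda>(i, k). \<Sum>e\<in>B1. ws1 ! i $ e * ws1 ! k $ e)"
  let ?G2 = "Matrix.mat ?m ?m (\<lambda>(i, k). \<Sum>e\<in>B2. ws2 ! i $ e * ws2 ! k $ e)"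
  let ?G = "Matrix.mat (?n + ?m) (?n + ?m)
     (\<lambda>(i, k). \<Sum>e\<in>B1 \<union> B2. (ws1 @ ws2) ! i $ e * (ws1 @ ws2) ! k $ e)"
  have split: "(\<Sum>e\<in>B1 \<union> B2. f e) = (\<Sum>e\<in>B1. f e) + (\<Sum>e\<in>B2. f e)" for f :: "'e \<Rightarrow> 'k"
    using B disj by (intro sum.union_disjoint) auto
  have z1: "ws1 ! i $ e = 0" if "i < ?n" "e \<in> B2" for i e
    using ws(1) nth_mem[OF that(1)] that(2) B disj unfolding coord_space_def by blast
  have z2: "ws2 ! i $ e = 0" if "i < ?m" "e \<in> B1" for i e
    using ws(2) nth_mem[OF that(1)] that(2) B disj unfolding coord_space_def by blast
  have "?G = four_block_mat ?G1 (0\<^sub>m ?n ?m) (0\<^sub>m ?m ?n) ?G2"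
    by (rule eq_matI) (auto simp: nth_append split z1 z2)
  then have "Determinant.det ?G = Determinant.det ?G1 * Determinant.det ?G2"
    using det_four_block_mat_lower_left_zero[of ?G1 ?n "0\<^sub>m ?n ?m" ?m "0\<^sub>m ?m ?n" ?G2] by simp
  then show ?thesis
    by (simp add: gram_det_def)
qed

lemma gram_det_concat:
  fixes ws :: "'i \<Rightarrow> ('k::field ^ 'e::finite) list"
  assumes "distinct xs"
    and "\<And>i. i \<in> set xs \<Longrightarrow> set (ws i) \<subseteq> coord_space (E i)"
    and "\<And>i. i \<in> set xs \<Longrightarrow> B i \<subseteq> E i"
    and "\<And>i j. i \<in> set xs \<Longrightarrow> j \<in> set xs \<Longrightarrow> i \<noteq> j \<Longrightarrow> E i \<inter> E j = {}"
  shows "gram_det (concat (map ws xs)) (\<Union>i\<in>set xs. B i) = (\<Prod>i\<in>set xs. gram_det (ws i) (B i))"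
  using assms
proof (induction xs)
  case Nil
  show ?case by (simp add: gram_det_def)
next
  case (Cons i xs)
  have "gram_det (ws i @ concat (map ws xs)) (B i \<union> (\<Union>j\<in>set xs. B j))
      = gram_det (ws i) (B i) * gram_det (concat (map ws xs)) (\<Union>j\<in>set xs. B j)"
  proof (rule gram_det_append[where ?E1.0 = "E i" and ?E2.0 = "\<Union>j\<in>set xs. E j"])
    have "coord_space (E j) \<subseteq> (coord_space (\<Union>j\<in>set xs. E j) :: ('k ^ 'e) set)" if "j \<in> set xs" for j
      using that by (auto simp: coord_space_def)
    moreover have "set (ws j) \<subseteq> coord_space (E j)" if "j \<in> set xs" for j
      using that Cons.prems(2) by simp
    ultimately show "set (concat (map ws xs)) \<subseteq> coord_space (\<Union>j\<in>set xs. E j)"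
      by auto
    show "(\<Union>j\<in>set xs. B j) \<subseteq> (\<Union>j\<in>set xs. E j)"
      using Cons.prems(3) by (intro UN_mono) auto
    have "E i \<inter> E j = {}" if "j \<in> set xs" for j
      using that Cons.prems(1,4) by (metis distinct.simps(2) list.set_intros)
    then show "E i \<inter> (\<Union>j\<in>set xs. E j) = {}"
      by blast
  qed (use Cons.prems in auto)
  moreover have "gram_det (concat (map ws xs)) (\<Union>j\<in>set xs. B j) = (\<Prod>j\<in>set xs. gram_det (ws j) (B j))"
    using Cons.prems by (intro Cons.IH) auto
  ultimately show ?case
    using Cons.prems(1) by simp
qed

lemma config_poly_eq_gram_sum:
  assumes "realizes W M" "ordered_basis W ws"
  shows "config_poly M ws = (\<Sum>B | matroid_basis M B. mv_const (gram_det ws B) * (\<Prod>e\<in>B. mv_var e))"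
  unfolding config_poly_def
  by (intro sum.cong) (simp_all add: gram_det_eq_minor_squared card_basis_eq_length[OF assms])

lemma mv_const_mult: "mv_const (a * b) = mv_const a * mv_const (b :: 'k::semiring_0)"
  by (simp add: mv_const_def mult_single)

lemma mv_const_prod: "finite I \<Longrightarrow> mv_const (\<Prod>i\<in>I. c i) = (\<Prod>i\<in>I. mv_const (c i :: 'k::comm_semiring_1))"
  by (induction I rule: finite_induct) (simp_all add: mv_const_mult mv_const_def[of 1])

text \<open>
  Distributing the product of the sums gives a sum over families of bases, one for each
  summand, and these families are the bases of \<open>M\<close>.
\<close>
lemma config_poly_concat:
  fixes W :: "('k::field ^ 'e::finite) set"
  assumes M: "matroid M" and summands: "\<And>i. i \<in> I \<Longrightarrow> matroid (N i)"
    and sum: "is_direct_sum M I N" and W: "realizes W M"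
    and xs: "distinct xs" "set xs = I"
    and ws: "\<And>i. i \<in> I \<Longrightarrow> ordered_basis (W \<inter> coord_space (ground (N i))) (ws i)"
  shows "config_poly M (concat (map ws xs)) = (\<Prod>i\<in>I. config_poly (N i) (ws i))"
proof -
  let ?t = "\<lambda>i B. mv_const (gram_det (ws i) B) * (\<Prod>e\<in>B. mv_var e) :: ('e, 'k) mv_poly"
  let ?F = "\<Pi>\<^sub>E i\<in>I. {B. matroid_basis (N i) B}"
  have fin: "finite I" using xs(2) by auto
  have V: "realizes (W \<inter> coord_space (ground (N i))) (N i)" if "i \<in> I" for i
    by (rule realizes_summand[OF M summands sum W that])
  have product_term: "mv_const (gram_det (concat (map ws xs)) (\<Union>i\<in>I. S i)) * (\<Prod>e\<in>(\<Union>i\<in>I. S i). mv_var e)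
      = (\<Prod>i\<in>I. ?t i (S i))" if S: "S \<in> ?F" for S
  proof -
    have sub: "S i \<subseteq> ground (N i)" if "i \<in> I" for i
      using S that by (intro matroid_basis_subset_ground[OF summands]) (auto simp: PiE_iff)
    have "gram_det (concat (map ws xs)) (\<Union>i\<in>I. S i) = (\<Prod>i\<in>I. gram_det (ws i) (S i))"
      unfolding xs(2)[symmetric]
    proof (rule gram_det_concat[OF xs(1), where E = "\<lambda>i. ground (N i)"])
      fix i
      assume "i \<in> set xs"
      then have i: "i \<in> I" by (simp add: xs(2))
      show "S i \<subseteq> ground (N i)" by (rule sub[OF i])
      show "set (ws i) \<subseteq> coord_space (ground (N i))"
        using ws[OF i] vec.span_superset[of "set (ws i)"] unfolding ordered_basis_def by simp
    qed (use grounds_disjoint[OF sum] xs(2) in blast)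
    moreover have "(\<Prod>e\<in>(\<Union>i\<in>I. S i). mv_var e) = (\<Prod>i\<in>I. \<Prod>e\<in>S i. mv_var e :: ('e, 'k) mv_poly)"
    proof (rule prod.UNION_disjoint[OF fin], simp, intro ballI impI)
      fix i j
      assume ij: "i \<in> I" "j \<in> I" "i \<noteq> j"
      show "S i \<inter> S j = {}"
        using grounds_disjoint[OF sum ij] sub[OF ij(1)] sub[OF ij(2)] by blast
    qed
    ultimately show ?thesis
      using fin by (simp add: mv_const_prod prod.distrib)
  qed
  have "config_poly M (concat (map ws xs))
      = (\<Sum>B | matroid_basis M B. mv_const (gram_det (concat (map ws xs)) B) * (\<Prod>e\<in>B. mv_var e))"
    by (rule config_poly_eq_gram_sum[OF W ordered_basis_concat[OF M summands sum W xs ws]])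
  also have "\<dots> = (\<Sum>S\<in>?F. mv_const (gram_det (concat (map ws xs)) (\<Union>i\<in>I. S i)) *
      (\<Prod>e\<in>(\<Union>i\<in>I. S i). mv_var e))"
    by (rule sum.reindex_bij_betw[OF bases_bij_betw_families[OF summands sum], symmetric])
  also have "\<dots> = (\<Sum>S\<in>?F. \<Prod>i\<in>I. ?t i (S i))"
    by (intro sum.cong refl product_term)
  also have "\<dots> = (\<Prod>i\<in>I. \<Sum>B | matroid_basis (N i) B. ?t i B)"
    using fin by (intro prod_sum_PiE[symmetric]) auto
  also have "\<dots> = (\<Prod>i\<in>I. config_poly (N i) (ws i))"
    using config_poly_eq_gram_sum[OF V ws] by (intro prod.cong) simp_all
  finally show ?thesis .
qed

section \<open>Change of basis and factors of configuration polynomials\<close>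

text \<open>
  All maximal minors change by the determinant of the transition matrix, which is
  nonzero since the minor at a basis of \<open>M\<close> is nonzero for either choice.
\<close>
lemma config_poly_change_of_basis:
  fixes W :: "('k::field ^ 'e::finite) set"
  assumes M: "matroid M" and W: "realizes W M"
    and ws: "ordered_basis W ws" and us: "ordered_basis W us"
  shows "\<exists>d. d \<noteq> 0 \<and> config_poly M ws = mv_const (d\<^sup>2) * config_poly M us"
proof -
  let ?n = "length us"
  have len: "length ws = ?n"
    using length_ordered_basis[OF ws] length_ordered_basis[OF us] by simp
  have "\<exists>t. ws ! i = (\<Sum>k<?n. t k *s us ! k)" if i: "i < ?n" for i
  proof -
    have "ws ! i \<in> vec.span (set us)"
      using ws us len i nth_mem[of i ws] vec.span_base[of "ws ! i" "set ws"]
      unfolding ordered_basis_def by simp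
    then obtain u where "ws ! i = (\<Sum>v\<in>set us. u v *s v)"
      by (auto simp: vec.span_finite)
    also have "\<dots> = (\<Sum>k<?n. u (us ! k) *s us ! k)"
      using us by (intro sum_distinct_list) (simp add: ordered_basis_def)
    finally show ?thesis
      by (rule exI[of _ "\<lambda>k. u (us ! k)"])
  qed
  then obtain t where t: "\<And>i. i < ?n \<Longrightarrow> ws ! i = (\<Sum>k<?n. t i k *s us ! k)"
    by metis
  let ?T = "Matrix.mat ?n ?n (\<lambda>(i, k). t i k)"
  have minor: "maximal_minor ws B = Determinant.det ?T * maximal_minor us B" for B
  proof -
    let ?A = "Matrix.mat ?n ?n (\<lambda>(i, j). us ! i $ (enumeration B ! j))"
    have "Matrix.mat ?n ?n (\<lambda>(i, j). ws ! i $ (enumeration B ! j)) = ?T * ?A"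
      by (rule eq_matI) (simp_all add: t scalar_prod_def lessThan_atLeast0)
    then show ?thesis
      using det_mult[of ?T ?n ?A] by (simp add: maximal_minor_def len)
  qed
  obtain B where "matroid_basis M B"
    using matroid_basis_exists[OF M] by blast
  then have "maximal_minor ws B \<noteq> 0"
    by (rule maximal_minor_nonzero[OF W ws])
  then have "Determinant.det ?T \<noteq> 0"
    using minor[of B] by auto
  moreover have "config_poly M ws = mv_const ((Determinant.det ?T)\<^sup>2) * config_poly M us"
    unfolding config_poly_def
    by (simp add: minor power_mult_distrib mv_const_mult sum_distrib_left mult.assoc)
  ultimately show ?thesis by blast
qed

text \<open>
  Multiplying one basis vector by \<open>d\<close> multiplies every minor by \<open>d\<close>; in dimension zero there is
  no vector to rescale.
\<close>
lemma is_config_poly_scale: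
  fixes V :: "('k::field ^ 'e::finite) set"
  assumes V: "vec.subspace V" and q: "is_config_poly M V q" and dim: "vec.dim V > 0" and d: "d \<noteq> 0"
  shows "is_config_poly M V (mv_const (d\<^sup>2) * q)"
proof -
  obtain ws where ws: "ordered_basis V ws" and q_ws: "q = config_poly M ws"
    using q unfolding is_config_poly_def by blast
  have "ws \<noteq> []"
    using length_ordered_basis[OF ws] dim by (metis less_irrefl list.size(3))
  then obtain u us where ws_Cons: "ws = u # us"
    by (cases ws) auto
  let ?vs = "(d *s u) # us"
  have span: "vec.span (insert u (set us)) = V"
    using ws by (simp add: ordered_basis_def ws_Cons)
  then have sub: "u \<in> V" "set us \<subseteq> V"
    using vec.span_superset by blast+
  have basis: "ordered_basis V ?vs"
  proof (rule ordered_basisI[OF _ _ V])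
    show "set ?vs \<subseteq> V"
      using sub V by (simp add: vec.subspace_scale)
    have "inverse d *s (d *s u) \<in> vec.span (set ?vs)"
      by (intro vec.span_scale vec.span_base) simp
    then have "u \<in> vec.span (set ?vs)"
      using d by simp
    moreover have "set us \<subseteq> vec.span (set ?vs)"
      using vec.span_superset[of "set ?vs"] by simp
    ultimately have "vec.span (insert u (set us)) \<subseteq> vec.span (set ?vs)"
      by (intro vec.span_minimal) auto
    then show "V \<subseteq> vec.span (set ?vs)"
      by (simp add: span)
    show "length ?vs \<le> vec.dim V"
      using length_ordered_basis[OF ws] by (simp add: ws_Cons)
  qed
  have minor: "maximal_minor ?vs B = d * maximal_minor ws B" for B
  proof -
    let ?n = "length ws"
    let ?A = "Matrix.mat ?n ?n (\<lambda>(i, j). ws ! i $ (enumeration B ! j))"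
    have "Matrix.mat ?n ?n (\<lambda>(i, j). ?vs ! i $ (enumeration B ! j)) = multrow 0 d ?A"
      by (rule eq_matI) (auto simp: ws_Cons nth_Cons')
    then show ?thesis
      using det_multrow[of 0 ?n ?A d] by (simp add: maximal_minor_def ws_Cons)
  qed
  have "config_poly M ?vs = mv_const (d\<^sup>2) * config_poly M ws"
    unfolding config_poly_def
    by (simp add: minor power_mult_distrib mv_const_mult sum_distrib_left mult.assoc)
  with basis show ?thesis
    unfolding is_config_poly_def q_ws by metis
qed

lemma is_config_poly_prod:
  fixes W :: "('k::field ^ 'e::finite) set"
  assumes M: "matroid M" and fin: "finite I" and summands: "\<And>i. i \<in> I \<Longrightarrow> matroid (N i)"
    and sum: "is_direct_sum M I N" and W: "realizes W M"
    and q: "\<And>i. i \<in> I \<Longrightarrow> is_config_poly (N i) (W \<inter> coord_space (ground (N i))) (q i)"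
  shows "is_config_poly M W (\<Prod>i\<in>I. q i)"
proof -
  obtain ws where ws: "\<And>i. i \<in> I \<Longrightarrow> ordered_basis (W \<inter> coord_space (ground (N i))) (ws i)"
      "\<And>i. i \<in> I \<Longrightarrow> q i = config_poly (N i) (ws i)"
    using q unfolding is_config_poly_def by metis
  obtain xs where xs: "distinct xs" "set xs = I"
    using finite_distinct_list[OF fin] by blast
  have "ordered_basis W (concat (map ws xs))"
    by (rule ordered_basis_concat[OF M summands sum W xs ws(1)])
  moreover have "(\<Prod>i\<in>I. q i) = config_poly M (concat (map ws xs))"
    using config_poly_concat[OF M summands sum W xs ws(1)] ws(2) by simp
  ultimately show ?thesis
    unfolding is_config_poly_def by blast
qed

text \<open>
  Any choice of factors gives \<open>p\<close> up to a nonzero square, which can be absorbed into a factor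
  of positive rank.
\<close>
lemma is_config_poly_factors:
  fixes W :: "('k::field ^ 'e::finite) set"
  assumes M: "matroid M" and rank: "matroid_rank M \<ge> 1" and fin: "finite I"
    and summands: "\<And>i. i \<in> I \<Longrightarrow> matroid (N i)"
    and sum: "is_direct_sum M I N" and W: "realizes W M" and p: "is_config_poly M W p"
  shows "\<exists>q. (\<forall>i\<in>I. is_config_poly (N i) (W \<inter> coord_space (ground (N i))) (q i)) \<and> p = (\<Prod>i\<in>I. q i)"
proof -
  let ?V = "\<lambda>i. W \<inter> coord_space (ground (N i))"
  have V: "realizes (?V i) (N i)" if "i \<in> I" for i
    by (rule realizes_summand[OF M summands sum W that])
  have "\<forall>i. \<exists>q. i \<in> I \<longrightarrow> is_config_poly (N i) (?V i) q"
    using ex_is_config_poly V unfolding realizes_def by blast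
  then obtain q where q: "\<And>i. i \<in> I \<Longrightarrow> is_config_poly (N i) (?V i) (q i)"
    by metis
  have "is_config_poly M W (\<Prod>i\<in>I. q i)"
    by (rule is_config_poly_prod[OF M fin summands sum W q])
  then obtain d where d: "d \<noteq> 0" "p = mv_const (d\<^sup>2) * (\<Prod>i\<in>I. q i)"
    using p config_poly_change_of_basis[OF M W] unfolding is_config_poly_def by metis
  obtain B where B: "matroid_basis M B" "B \<noteq> {}"
    using rank rank_pos_iff_nonempty_basis[OF M] by blast
  obtain j where j: "j \<in> I" "B \<inter> ground (N j) \<noteq> {}"
    using B(2) basis_eq_union_components[OF summands sum B(1)] by blast
  have "vec.dim (?V j) > 0"
    using card_basis_eq_dim[OF V basis_component[OF summands sum B(1)], OF j(1) _ j(1)] j(2)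
    by (metis card_gt_0_iff finite)
  then have qj: "is_config_poly (N j) (?V j) (mv_const (d\<^sup>2) * q j)"
    using V[OF j(1)] q[OF j(1)] d(1) by (intro is_config_poly_scale) (simp_all add: realizes_def)
  let ?q = "q(j := mv_const (d\<^sup>2) * q j)"
  have "p = mv_const (d\<^sup>2) * (q j * (\<Prod>i\<in>I - {j}. q i))"
    using d(2) prod.remove[OF fin j(1), of q] by simp
  also have "\<dots> = ?q j * (\<Prod>i\<in>I - {j}. ?q i)"
    by (simp add: mult.assoc)
  also have "\<dots> = (\<Prod>i\<in>I. ?q i)"
    by (rule prod.remove[OF fin j(1), symmetric])
  finally have "p = (\<Prod>i\<in>I. ?q i)" .
  moreover have "\<forall>i\<in>I. is_config_poly (N i) (?V i) (?q i)"
    using q qj by simp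
  ultimately show ?thesis by blast
qed

section \<open>The support of a configuration polynomial\<close>

definition set_monomial :: "'e set \<Rightarrow> 'e \<Rightarrow>\<^sub>0 nat" where
  "set_monomial B = (\<Sum>e\<in>B. Poly_Mapping.single e 1)"

lemma lookup_set_monomial:
  "Poly_Mapping.lookup (set_monomial B) e = (if e \<in> B then 1 else 0)" for B :: "'e::finite set"
  by (simp add: set_monomial_def lookup_sum lookup_single when_def)

lemma inj_set_monomial: "inj (set_monomial :: 'e::finite set \<Rightarrow> _)"
proof (rule injI)
  fix A B :: "'e set"
  assume "set_monomial A = set_monomial B"
  then have "(if e \<in> A then 1 else 0 :: nat) = (if e \<in> B then 1 else 0)" for e
    by (metis lookup_set_monomial)
  then show "A = B"
    by (metis subsetI subset_antisym zero_neq_one)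
qed

lemma prod_mv_var:
  "(\<Prod>e\<in>B. mv_var e) = (Poly_Mapping.single (set_monomial B) 1 :: ('e::finite, 'k::comm_semiring_1) mv_poly)"
proof -
  have "finite B" by simp
  then show ?thesis
    by (induction B rule: finite_induct) (simp_all add: set_monomial_def mv_var_def mult_single)
qed

lemma keys_config_poly:
  fixes W :: "('k::field ^ 'e::finite) set"
  assumes W: "realizes W M" and ws: "ordered_basis W ws"
  shows "Poly_Mapping.keys (config_poly M ws) = set_monomial ` {B. matroid_basis M B}"
proof -
  have "config_poly M ws = (\<Sum>B | matroid_basis M B. Poly_Mapping.single (set_monomial B) ((maximal_minor ws B)\<^sup>2))"
    by (simp add: config_poly_def mv_const_def prod_mv_var mult_single)
  then have lookup: "Poly_Mapping.lookup (config_poly M ws) m =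
      (\<Sum>B | matroid_basis M B. if set_monomial B = m then (maximal_minor ws B)\<^sup>2 else 0)" for m
    by (simp add: lookup_sum lookup_single when_def)
  show ?thesis
  proof (intro subset_antisym subsetI)
    fix m
    assume "m \<in> Poly_Mapping.keys (config_poly M ws)"
    then obtain B where "matroid_basis M B" "(if set_monomial B = m then (maximal_minor ws B)\<^sup>2 else 0) \<noteq> 0"
      unfolding in_keys_iff lookup by (elim sum.not_neutral_contains_not_neutral) simp
    then show "m \<in> set_monomial ` {B. matroid_basis M B}"
      by (auto split: if_splits)
  next
    fix m
    assume "m \<in> set_monomial ` {B. matroid_basis M B}"
    then obtain B where B: "matroid_basis M B" "m = set_monomial B" by blast
    have "Poly_Mapping.lookup (config_poly M ws) m =
        (\<Sum>B' | matroid_basis M B'. if B' = B then (maximal_minor ws B)\<^sup>2 else 0)"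
      unfolding lookup B(2) inj_eq[OF inj_set_monomial] by (intro sum.cong) auto
    also have "\<dots> = (maximal_minor ws B)\<^sup>2"
      using B(1) by simp
    finally show "m \<in> Poly_Mapping.keys (config_poly M ws)"
      using maximal_minor_nonzero[OF W ws B(1)] by (simp add: in_keys_iff)
  qed
qed

lemma config_poly_multilinear:
  assumes "realizes W M" "ordered_basis W ws"
  shows "multilinear (config_poly M ws)"
  by (auto simp: multilinear_def keys_config_poly[OF assms] lookup_set_monomial)

text \<open>
  As \<open>1\<close> is multilinear, no cancellation can take place in a factorization of it, and the
  monomial of a nonempty basis would survive there.
\<close>
lemma config_poly_not_unit:
  fixes W :: "('k::field ^ 'e::finite) set"
  assumes W: "realizes W M" and ws: "ordered_basis W ws" and B: "matroid_basis M B" "B \<noteq> {}"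
  shows "\<not> config_poly M ws dvd 1"
proof
  assume "config_poly M ws dvd 1"
  then obtain q where q: "1 = config_poly M ws * q" by (elim dvdE)
  have keys_q: "Poly_Mapping.keys q \<noteq> {}"
    using q by auto
  then obtain b where b: "b \<in> Poly_Mapping.keys q" by blast
  have "multilinear (1 :: ('e, 'k) mv_poly)"
    by (simp add: multilinear_def)
  then have "set_monomial B + b \<in> Poly_Mapping.keys (1 :: ('e, 'k) mv_poly)"
    using keys_mult_multilinear[of "config_poly M ws" q "set_monomial B" b] b B(1)
    by (simp add: keys_config_poly[OF W ws] q[symmetric])
  then have "set_monomial B + b = 0"
    by simp
  then have "Poly_Mapping.lookup (set_monomial B) e = 0" for e
    by (metis add_is_0 lookup_add lookup_zero)
  moreover obtain e where "e \<in> B" using B(2) by blast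
  ultimately show False
    using lookup_set_monomial[of B e] by simp
qed

section \<open>Connectedness and irreducibility\<close>

text \<open>
  The two factors of \<open>\<psi>\<close> have disjoint sets of variables and supports whose sumset is the set of
  bases; choosing the first summand from one basis and the second from another yields the
  recombination that separates \<open>M\<close>.
\<close>
lemma irreducible_config_poly:
  fixes W :: "('k::field ^ 'e::finite) set"
  assumes M: "matroid M" "connected_matroid M" "matroid_rank M \<ge> 1"
    and W: "realizes W M" and ws: "ordered_basis W ws"
  shows "irreducible (config_poly M ws)"
proof (rule irreducibleI)
  obtain B0 where B0: "matroid_basis M B0" "B0 \<noteq> {}"
    using M rank_pos_iff_nonempty_basis by blast
  note keys = keys_config_poly[OF W ws]
  show nz: "config_poly M ws \<noteq> 0"
    using keys B0(1) by auto
  show "\<not> config_poly M ws dvd 1"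
    by (rule config_poly_not_unit[OF W ws B0])
  fix a b
  assume ab: "config_poly M ws = a * b"
  have ml: "multilinear (a * b)"
    using config_poly_multilinear[OF W ws] ab by simp
  have ab_nz: "a \<noteq> 0" "b \<noteq> 0" using ab nz by auto
  define vars where "vars r = {e. \<exists>m\<in>Poly_Mapping.keys r. Poly_Mapping.lookup m e \<noteq> 0}"
    for r :: "('e, 'k) mv_poly"
  have disj: "vars a \<inter> vars b = {}"
  proof (rule equals0I)
    fix e
    assume "e \<in> vars a \<inter> vars b"
    then obtain m n where "m \<in> Poly_Mapping.keys a" "n \<in> Poly_Mapping.keys b"
        "Poly_Mapping.lookup m e \<noteq> 0" "Poly_Mapping.lookup n e \<noteq> 0"
      unfolding vars_def by blast
    then show False
      using multilinear_factors_disjoint[OF ml, of m n e] by simp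
  qed
  have unit: "r dvd 1" if "vars r = {}" "r \<noteq> 0" for r :: "('e, 'k) mv_poly"
  proof (rule constant_poly_dvd_one[OF _ that(2)])
    show "Poly_Mapping.keys r \<subseteq> {0}"
    proof
      fix m
      assume "m \<in> Poly_Mapping.keys r"
      with that(1) have "Poly_Mapping.lookup m e = 0" for e
        by (auto simp: vars_def)
      then show "m \<in> {0}"
        by (simp add: poly_mapping_eqI)
    qed
  qed
  have product_basis: "\<exists>B. matroid_basis M B \<and> m + n = set_monomial B"
    if "m \<in> Poly_Mapping.keys a" "n \<in> Poly_Mapping.keys b" for m n
    using keys_mult_multilinear[OF ml that] keys unfolding ab by blast
  have basis_product: "\<exists>m\<in>Poly_Mapping.keys a. \<exists>n\<in>Poly_Mapping.keys b. set_monomial B = m + n"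
    if B: "matroid_basis M B" for B
  proof -
    have "set_monomial B \<in> Poly_Mapping.keys (a * b)"
      using keys B by (simp flip: ab)
    then show ?thesis
      using keys_mult[of a b] by blast
  qed
  have vars_ground: "vars a \<union> vars b \<subseteq> ground M"
  proof
    fix e
    assume e: "e \<in> vars a \<union> vars b"
    obtain m n where mn: "m \<in> Poly_Mapping.keys a" "n \<in> Poly_Mapping.keys b"
      and pos: "Poly_Mapping.lookup (m + n) e \<noteq> 0"
    proof -
      obtain m0 n0 where 0: "m0 \<in> Poly_Mapping.keys a" "n0 \<in> Poly_Mapping.keys b"
        using ab_nz by (metis all_not_in_conv keys_eq_empty)
      show ?thesis
        using e that 0 by (auto simp: vars_def lookup_add)
    qed
    obtain B where "matroid_basis M B" "m + n = set_monomial B"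
      using product_basis[OF mn] by blast
    then show "e \<in> ground M"
      using pos matroid_basis_subset_ground[OF M(1)] by (auto simp: lookup_set_monomial split: if_splits)
  qed
  show "a dvd 1 \<or> b dvd 1"
  proof (rule ccontr)
    assume "\<not> (a dvd 1 \<or> b dvd 1)"
    then have ne: "vars a \<noteq> {}" "vars b \<noteq> {}"
      using unit ab_nz by blast+
    have "\<not> connected_matroid M"
    proof (rule bases_split_imp_disconnected[OF M(1)])
      show "vars a \<subseteq> ground M" "vars a \<noteq> {}" "vars a \<noteq> ground M"
        using vars_ground ne disj by blast+
      fix B B'
      assume B: "matroid_basis M B" and B': "matroid_basis M B'"
      obtain m n where mn: "m \<in> Poly_Mapping.keys a" "n \<in> Poly_Mapping.keys b" "set_monomial B = m + n"
        using basis_product[OF B] by blast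
      obtain m' n' where mn': "m' \<in> Poly_Mapping.keys a" "n' \<in> Poly_Mapping.keys b" "set_monomial B' = m' + n'"
        using basis_product[OF B'] by blast
      obtain C where C: "matroid_basis M C" "m + n' = set_monomial C"
        using product_basis[OF mn(1) mn'(2)] by blast
      \<comment> \<open>The monomial of \<open>C\<close> takes its \<open>a\<close>-part from \<open>B\<close> and its \<open>b\<close>-part from \<open>B'\<close>.\<close>
      have "e \<in> C \<longleftrightarrow> e \<in> (B \<inter> vars a) \<union> (B' - vars a)" for e
      proof -
        have lookup_B: "Poly_Mapping.lookup m e + Poly_Mapping.lookup n e = (if e \<in> B then 1 else 0)"
          by (metis lookup_add lookup_set_monomial mn(3))
        have lookup_B': "Poly_Mapping.lookup m' e + Poly_Mapping.lookup n' e = (if e \<in> B' then 1 else 0)"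
          by (metis lookup_add lookup_set_monomial mn'(3))
        have lookup_C: "Poly_Mapping.lookup m e + Poly_Mapping.lookup n' e = (if e \<in> C then 1 else 0)"
          by (metis lookup_add lookup_set_monomial C(2))
        show ?thesis
        proof (cases "e \<in> vars a")
          case True
          then have "e \<notin> vars b" using disj by blast
          then have "Poly_Mapping.lookup n e = 0" "Poly_Mapping.lookup n' e = 0"
            using mn(2) mn'(2) by (auto simp: vars_def)
          with lookup_B lookup_C have "(if e \<in> C then 1 else 0 :: nat) = (if e \<in> B then 1 else 0)"
            by linarith
          then have "e \<in> C \<longleftrightarrow> e \<in> B"
            by (simp split: if_splits)
          with True show ?thesis by blast
        next
          case False
          then have "Poly_Mapping.lookup m e = 0" "Poly_Mapping.lookup m' e = 0"
            using mn(1) mn'(1) by (auto simp: vars_def)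
          with lookup_B' lookup_C have "(if e \<in> C then 1 else 0 :: nat) = (if e \<in> B' then 1 else 0)"
            by linarith
          then have "e \<in> C \<longleftrightarrow> e \<in> B'"
            by (simp split: if_splits)
          with False show ?thesis by blast
        qed
      qed
      then have "C = (B \<inter> vars a) \<union> (B' - vars a)"
        by blast
      with C(1) show "matroid_basis M ((B \<inter> vars a) \<union> (B' - vars a))"
        by simp
    qed
    with M(2) show False by blast
  qed
qed

lemma config_poly_rank_zero:
  fixes W :: "('k::field ^ 'e::finite) set"
  assumes M: "matroid M" "\<not> matroid_rank M \<ge> 1" and W: "realizes W M" and ws: "ordered_basis W ws"
  shows "config_poly M ws = 1"
proof -
  have "B = {}" if "matroid_basis M B" for B
    using M that rank_pos_iff_nonempty_basis by blast
  moreover obtain B where "matroid_basis M B"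
    using matroid_basis_exists[OF M(1)] by blast
  ultimately have basis: "matroid_basis M B \<longleftrightarrow> B = {}" for B
    by metis
  then have "length ws = 0"
    using card_basis_eq_length[OF W ws, of "{}"] by simp
  then have "maximal_minor ws {} = 1"
    by (simp add: maximal_minor_def)
  then show ?thesis
    by (simp add: config_poly_def basis mv_const_def)
qed

text \<open>
  Without loops, each summand of a decomposition contains an element of a basis, hence
  contributes a nonunit factor.
\<close>
lemma irreducible_imp_connected:
  fixes W :: "('k::field ^ 'e::finite) set"
  assumes M: "matroid M" "matroid_rank M \<ge> 1" and W: "realizes W M" and p: "is_config_poly M W p"
    and no_loop: "\<nexists>e. loop M e" and irr: "irreducible p"
  shows "connected_matroid M"
proof (rule ccontr)
  assume "\<not> connected_matroid M"
  then obtain N :: "bool \<Rightarrow> 'e pre_matroid"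
    where N: "\<And>b. matroid (N b)" "\<And>b. ground (N b) \<noteq> {}" and sum: "is_direct_sum M UNIV N"
    unfolding connected_matroid_def by blast
  let ?V = "\<lambda>b. W \<inter> coord_space (ground (N b))"
  obtain q where q: "\<And>b. is_config_poly (N b) (?V b) (q b)" and p_prod: "p = (\<Prod>b\<in>UNIV. q b)"
    using is_config_poly_factors[OF M finite N(1) sum W p] by blast
  have "\<not> q b dvd 1" for b
  proof -
    obtain e where e: "e \<in> ground (N b)" using N(2) by blast
    then have "e \<in> ground M"
      using sum by (auto simp: is_direct_sum_def)
    with no_loop obtain B where B: "matroid_basis M B" "e \<in> B"
      unfolding loop_def by blast
    have Bb: "matroid_basis (N b) (B \<inter> ground (N b))" "B \<inter> ground (N b) \<noteq> {}"
      using basis_component[OF N(1) sum B(1)] B(2) e by auto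
    have Vb: "realizes (?V b) (N b)"
      by (rule realizes_summand[OF M(1) N(1) sum W]) simp
    obtain ws where "ordered_basis (?V b) ws" "q b = config_poly (N b) ws"
      using q[of b] unfolding is_config_poly_def by blast
    then show ?thesis
      using config_poly_not_unit[OF Vb _ Bb] by simp
  qed
  moreover have "p = q True * q False"
    by (simp add: p_prod UNIV_bool mult.commute)
  ultimately show False
    using irreducibleD[OF irr] by blast
qed

theorem proposition3p8:
  fixes M :: "'e::finite pre_matroid"
    and W :: "('k::field ^ 'e) set"
  assumes "matroid M"
    and "ground M = UNIV"
    and "realizes W M"
    and "matroid_rank M \<ge> 1"
  shows "(\<forall>p. is_config_poly M W p \<longrightarrow>
            (connected_matroid M \<longleftrightarrow> (\<nexists>e. loop M e) \<and> irreducible p)) \<and>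
         (\<forall>(n::nat) (N :: nat \<Rightarrow> 'e pre_matroid) (V :: nat \<Rightarrow> ('k ^ 'e) set).
            (\<forall>i<n. matroid (N i) \<and> ground (N i) \<noteq> {} \<and> connected_matroid (N i)) \<longrightarrow>
            is_direct_sum M {..<n} N \<longrightarrow>
            (\<forall>i<n. V i = W \<inter> coord_space (ground (N i))) \<longrightarrow>
              (\<forall>q. (\<forall>i<n. is_config_poly (N i) (V i) (q i)) \<longrightarrow>
                 is_config_poly M W (\<Prod>i<n. q i)) \<and>
              (\<forall>p. is_config_poly M W p \<longrightarrow>
                 (\<exists>q. (\<forall>i<n. is_config_poly (N i) (V i) (q i)) \<and> p = (\<Prod>i<n. q i))) \<and>
              (\<forall>i<n. \<forall>q. is_config_poly (N i) (V i) q \<longrightarrow>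
                 (if matroid_rank (N i) \<ge> 1 then irreducible q else q = 1)))"
proof (intro conjI allI impI)
  fix p
  assume p: "is_config_poly M W p"
  show "connected_matroid M \<longleftrightarrow> (\<nexists>e. loop M e) \<and> irreducible p"
  proof
    assume conn: "connected_matroid M"
    then have "irreducible p"
      using p irreducible_config_poly[OF assms(1) conn assms(4,3)] unfolding is_config_poly_def by blast
    with conn show "(\<nexists>e. loop M e) \<and> irreducible p"
      using connected_imp_no_loop[OF assms(1) conn assms(4)] by blast
  next
    assume "(\<nexists>e. loop M e) \<and> irreducible p"
    then show "connected_matroid M"
      using irreducible_imp_connected[OF assms(1,4,3) p] by blast
  qed
next
  fix n :: nat and N :: "nat \<Rightarrow> 'e pre_matroid" and V :: "nat \<Rightarrow> ('k ^ 'e) set"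
  assume N: "\<forall>i<n. matroid (N i) \<and> ground (N i) \<noteq> {} \<and> connected_matroid (N i)"
    and sum: "is_direct_sum M {..<n} N"
    and V: "\<forall>i<n. V i = W \<inter> coord_space (ground (N i))"
  have summands: "\<And>i. i \<in> {..<n} \<Longrightarrow> matroid (N i)"
    using N by simp
  {
    fix q
    assume "\<forall>i<n. is_config_poly (N i) (V i) (q i)"
    then show "is_config_poly M W (\<Prod>i<n. q i)"
      using V by (intro is_config_poly_prod[OF assms(1) finite_lessThan summands sum assms(3)]) auto
  next
    fix p
    assume p: "is_config_poly M W p"
    have "\<exists>q. (\<forall>i\<in>{..<n}. is_config_poly (N i) (W \<inter> coord_space (ground (N i))) (q i)) \<and> p = (\<Prod>i<n. q i)"
      by (rule is_config_poly_factors[OF assms(1,4) finite_lessThan _ sum assms(3) p]) (rule summands)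
    then show "\<exists>q. (\<forall>i<n. is_config_poly (N i) (V i) (q i)) \<and> p = (\<Prod>i<n. q i)"
      using V by auto
  next
    fix i q
    assume i: "i < n" and "is_config_poly (N i) (V i) q"
    then obtain ws where ws: "ordered_basis (V i) ws" "q = config_poly (N i) ws"
      unfolding is_config_poly_def by blast
    have Vi: "realizes (V i) (N i)"
      using realizes_summand[OF assms(1) summands sum assms(3), of i] V i by simp
    have Ni: "matroid (N i)" "connected_matroid (N i)"
      using N i by auto
    show "if matroid_rank (N i) \<ge> 1 then irreducible q else q = 1"
      using irreducible_config_poly[OF Ni _ Vi ws(1)] config_poly_rank_zero[OF Ni(1) _ Vi ws(1)] ws(2)
      by simp
  }
qed

end
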